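(* Let $E$ be a reflexive Banach space with the approximation property. Let $\mathcal{K}(E)$ be the Banach algebra of compact operators on $E$, and let $\mathcal{E}\ell(\mathcal{K}(E))$ be the algebra of elementary operators on $\mathcal{K}(E)$, equipped with the operator norm. Then the flip $$\mathcal{E}\ell(\mathcal{K}(E)) \to \mathcal{E}\ell(\mathcal{K}(E)), \qquad \Big[x \mapsto \sum_{j=1}^n a_j x b_j\Big] \mapsto \Big[x \mapsto \sum_{j=1}^n b_j x a_j\Big]$$ is continuous if and only if $\dim E < \infty$.
   Context: For an algebra $\mathfrak{A}$, a linear operator $T$ on $\mathfrak{A}$ is called elementary if there are $a_1,b_1,\dots,a_n,b_n \in \mathfrak{A}$ such that $Tx = \sum_{j=1}^n a_j x b_j$ for all $x \in \mathfrak{A}$. The set of all elementary operators on $\mathfrak{A}$ is denoted $\mathcal{E}\ell(\mathfrak{A})$; with composition as multiplication it is an algebra. If $\mathfrak{A}$ is a Banach algebra, $\mathcal{E}\ell(\mathfrak{A})$ consists of bounded operators and is normed by the operator norm of $\mathcal{B}(\mathfrak{A})$. Let $\mathfrak{A}^{\mathrm{op}}$ be $\mathfrak{A}$ with reversed multiplication. The canonical map $\mathfrak{A}\otimes\mathfrak{A}^{\mathrm{op}} \to \mathcal{E}\ell(\mathfrak{A})$ sends $\sum_j a_j\otimes b_j$ to $x\mapsto \sum_j a_j x b_j$ (algebraic tensor product). A Banach algebra $\mathfrak{A}$ is ultraprime if there is $C>0$ with $\sup\{\|axb\| : x\in\mathfrak{A},\ \|x\|\le 1\} \ge C\|a\|\|b\|$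 for all $a,b\in\mathfrak{A}$. It is known that for ultraprime $\mathfrak{A}$ the canonical map is an algebra isomorphism, and that every closed subalgebra of $\mathcal{B}(E)$ ($E$ a Banach space) containing the finite rank operators, in particular $\mathcal{K}(E)$ for $E$ as in the claim, is ultraprime. The flip on $\mathfrak{A}\otimes\mathfrak{A}^{\mathrm{op}}$ is the linear map determined by $a\otimes b\mapsto b\otimes a$; for ultraprime $\mathfrak{A}$ it is transported to a well-defined linear map on $\mathcal{E}\ell(\mathfrak{A})$, also called the flip. *)

theory Defs
  imports "HOL-Analysis.Analysis"
begin

text \<open>
  A Banach space over the scalar field \<open>'k\<close>. The only types of sort
  \<open>{real_normed_field, euclidean_space}\<close> are, up to isometric isomorphism, the real and the
  complex numbers, so real and complex Banach spaces are treated uniformly. The class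
  \<open>banach\<close> supplies the norm, its completeness and the underlying real vector space.
\<close>

locale banach_space_over = vector_space scl
  for scl :: "'k::{real_normed_field, euclidean_space} \<Rightarrow> 'e::banach \<Rightarrow> 'e" +
  assumes norm_scale: "norm (scl c x) = norm c * norm x"
    and scale_of_real: "scl (of_real r) x = r *\<^sub>R x"

text \<open>
  The type \<open>\<Rightarrow>\<^sub>L\<close> contains the bounded real-linear maps, with the operator norm; linearity over
  \<open>'k\<close> is required in addition.
\<close>

definition bounded_ops ::
    "('k::{real_normed_field, euclidean_space} \<Rightarrow> 'e::banach \<Rightarrow> 'e) \<Rightarrow> ('e \<Rightarrow>\<^sub>L 'e) set" where
  "bounded_ops scl = {T. Vector_Spaces.linear scl scl (blinfun_apply T)}"

definition dual_space ::
    "('k::{real_normed_field, euclidean_space} \<Rightarrow> 'e::banach \<Rightarrow> 'e) \<Rightarrow> ('e \<Rightarrow>\<^sub>L 'k) set" where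
  "dual_space scl = {\<phi>. Vector_Spaces.linear scl (*) (blinfun_apply \<phi>)}"

text \<open>Only the values on \<open>dual_space scl\<close> of a member of the bidual are meaningful.\<close>

definition bidual_space ::
    "('k::{real_normed_field, euclidean_space} \<Rightarrow> 'e::banach \<Rightarrow> 'e) \<Rightarrow> (('e \<Rightarrow>\<^sub>L 'k) \<Rightarrow> 'k) set" where
  "bidual_space scl =
    {F. (\<forall>\<phi>\<in>dual_space scl. \<forall>\<psi>\<in>dual_space scl. F (\<phi> + \<psi>) = F \<phi> + F \<psi>) \<and>
        (\<forall>c. \<forall>\<phi>\<in>dual_space scl. F (blinfun_mult_right c o\<^sub>L \<phi>) = c * F \<phi>) \<and>
        (\<exists>C. \<forall>\<phi>\<in>dual_space scl. norm (F \<phi>) \<le> C * norm \<phi>)}"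

definition reflexive_space ::
    "('k::{real_normed_field, euclidean_space} \<Rightarrow> 'e::banach \<Rightarrow> 'e) \<Rightarrow> bool" where
  "reflexive_space scl \<longleftrightarrow>
    (\<forall>F\<in>bidual_space scl. \<exists>x. \<forall>\<phi>\<in>dual_space scl. F \<phi> = blinfun_apply \<phi> x)"

definition finite_rank_ops ::
    "('k::{real_normed_field, euclidean_space} \<Rightarrow> 'e::banach \<Rightarrow> 'e) \<Rightarrow> ('e \<Rightarrow>\<^sub>L 'e) set" where
  "finite_rank_ops scl =
    {T \<in> bounded_ops scl. \<exists>B. finite B \<and> range (blinfun_apply T) \<subseteq> module.span scl B}"

definition approximation_property ::
    "('k::{real_normed_field, euclidean_space} \<Rightarrow> 'e::banach \<Rightarrow> 'e) \<Rightarrow> bool" where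
  "approximation_property scl \<longleftrightarrow>
    (\<forall>K. compact K \<longrightarrow>
      (\<forall>\<epsilon>>0. \<exists>T\<in>finite_rank_ops scl. \<forall>x\<in>K. norm (blinfun_apply T x - x) < \<epsilon>))"

definition compact_ops ::
    "('k::{real_normed_field, euclidean_space} \<Rightarrow> 'e::banach \<Rightarrow> 'e) \<Rightarrow> ('e \<Rightarrow>\<^sub>L 'e) set" where
  "compact_ops scl =
    {T \<in> bounded_ops scl. compact (closure (blinfun_apply T ` cball 0 1))}"

text \<open>
  For an algebra \<open>A\<close> of bounded operators, the list \<open>[(a\<^sub>1, b\<^sub>1), \<dots>, (a\<^sub>n, b\<^sub>n)]\<close> represents the
  tensor \<open>\<Sum>\<^sub>j a\<^sub>j \<otimes> b\<^sub>j\<close>. Maps on \<open>A\<close> are \<open>undefined\<close> outside \<open>A\<close>, so that two of them are equal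
  iff they agree on \<open>A\<close>.
\<close>

definition elementary_op ::
    "('e::banach \<Rightarrow>\<^sub>L 'e) set \<Rightarrow> (('e \<Rightarrow>\<^sub>L 'e) \<times> ('e \<Rightarrow>\<^sub>L 'e)) list \<Rightarrow> ('e \<Rightarrow>\<^sub>L 'e) \<Rightarrow> ('e \<Rightarrow>\<^sub>L 'e)" where
  "elementary_op A ps = (\<lambda>x\<in>A. \<Sum>(a, b)\<leftarrow>ps. a o\<^sub>L x o\<^sub>L b)"

definition elementary_ops ::
    "('e::banach \<Rightarrow>\<^sub>L 'e) set \<Rightarrow> (('e \<Rightarrow>\<^sub>L 'e) \<Rightarrow> ('e \<Rightarrow>\<^sub>L 'e)) set" where
  "elementary_ops A = {elementary_op A ps |ps. set ps \<subseteq> A \<times> A}"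

text \<open>
  The description determines the value uniquely whenever the canonical map from the tensor product
  of \<open>A\<close> and its opposite is injective, in particular if \<open>A\<close> is ultraprime.
\<close>

definition elementary_flip ::
    "('e::banach \<Rightarrow>\<^sub>L 'e) set \<Rightarrow> (('e \<Rightarrow>\<^sub>L 'e) \<Rightarrow> ('e \<Rightarrow>\<^sub>L 'e)) \<Rightarrow> (('e \<Rightarrow>\<^sub>L 'e) \<Rightarrow> ('e \<Rightarrow>\<^sub>L 'e))" where
  "elementary_flip A T =
    (THE S. \<exists>ps. set ps \<subseteq> A \<times> A \<and> T = elementary_op A ps \<and>
                 S = elementary_op A (map prod.swap ps))"

definition norm_on ::
    "('e::banach \<Rightarrow>\<^sub>L 'e) set \<Rightarrow> (('e \<Rightarrow>\<^sub>L 'e) \<Rightarrow> ('e \<Rightarrow>\<^sub>L 'e)) \<Rightarrow> real" where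
  "norm_on A T = (SUP x\<in>{x\<in>A. norm x \<le> 1}. norm (T x))"

definition norm_continuous_on ::
    "('e::banach \<Rightarrow>\<^sub>L 'e) set \<Rightarrow> (('e \<Rightarrow>\<^sub>L 'e) \<Rightarrow> ('e \<Rightarrow>\<^sub>L 'e)) set \<Rightarrow>
      ((('e \<Rightarrow>\<^sub>L 'e) \<Rightarrow> ('e \<Rightarrow>\<^sub>L 'e)) \<Rightarrow> (('e \<Rightarrow>\<^sub>L 'e) \<Rightarrow> ('e \<Rightarrow>\<^sub>L 'e))) \<Rightarrow> bool" where
  "norm_continuous_on A M \<Phi> \<longleftrightarrow>
    (\<forall>T\<in>M. \<forall>\<epsilon>>0. \<exists>\<delta>>0. \<forall>S\<in>M. norm_on A (\<lambda>x. S x - T x) < \<delta> \<longrightarrow>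
      norm_on A (\<lambda>x. \<Phi> S x - \<Phi> T x) < \<epsilon>)"

end

theory Submission
  imports Defs
begin

text \<open>
  On tensors built from rank-one operators, continuity of the flip says that the trace form satisfies
  \<open>\<bar>tr (x u)\<bar> \<le> C \<parallel>x\<parallel> \<parallel>u\<parallel>\<close> for compact \<open>x\<close> and finite-rank \<open>u\<close>. An operator \<open>V\<close> whose trace
  functional \<open>u \<mapsto> tr (V u)\<close> is bounded in the operator norm is absolutely summing, hence compact,
  because \<open>E\<close> is reflexive. Consequently, by Hahn--Banach, the nuclear norm is bounded by a multiple
  of the operator norm on finite-rank operators; by the approximation property the trace itself is
  then bounded in the operator norm. So \<open>V = id\<close> is admissible, the identity is compact, and
  \<open>dim E < \<infinity>\<close>. Conversely, the identity \<open>\<langle>g, flip T (v \<otimes> \<psi>) y\<rangle> = \<langle>\<psi>, T (y \<otimes> g) v\<rangle>\<close> shows that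
  the flip is well defined, and bounded if the identity operator has finite rank.
\<close>

subsection \<open>Sublinear functionals\<close>

text \<open>Continuity of the flip controls \<open>tr (x u)\<close> only for compact
  \<open>x\<close>, whereas the identity is the very operator whose compactness is at stake.
  Hahn-Banach for the nuclear norm alone would give a functional \<open>tr (V u)\<close> with
  \<open>norm V \<le> 1\<close>, but no reason for \<open>V\<close> to be compact. Hence the nuclear
  norm is first mixed with a penalty of \<open>K\<close> times the operator norm. For every finite
  \<open>K\<close> the penalty bounds the functional in the operator norm, which is enough for
  compactness of \<open>V\<close>; the trace estimate that then becomes available has the constant
  \<open>C\<close>, whatever \<open>K\<close> is. So \<open>K\<close> may be chosen after
  \<open>C\<close>, and \<open>K = 2 * (C + 1)\<close> leaves an approximation error of at most half
  the norm, which can be iterated. The resulting nuclear series has a trace of the right size; that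
  this is the trace of the given tensor is the classical content of the approximation
  property.\<close>

definition sublinear :: "('a::real_vector \<Rightarrow> real) \<Rightarrow> bool" where
  "sublinear p \<longleftrightarrow> (\<forall>x y. p (x + y) \<le> p x + p y) \<and> (\<forall>r\<ge>0. \<forall>x. p (r *\<^sub>R x) = r * p x)"

lemma sublinearI:
  assumes "\<And>x y. p (x + y) \<le> p x + p y" "p 0 = 0" "\<And>r x. r > 0 \<Longrightarrow> p (r *\<^sub>R x) \<le> r * p x"
  shows "sublinear p"
  unfolding sublinear_def
proof (intro conjI allI impI)
  fix r :: real and x assume "r \<ge> 0"
  show "p (r *\<^sub>R x) = r * p x"
  proof (cases "r = 0")
    case False
    with \<open>r \<ge> 0\<close> have r: "r > 0" by simp
    have "p x \<le> (1 / r) * p (r *\<^sub>R x)"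
      using assms(3)[of "1 / r" "r *\<^sub>R x"] r by simp
    hence "r * p x \<le> p (r *\<^sub>R x)" using r by (simp add: field_simps)
    with assms(3)[OF r, of x] show ?thesis by simp
  qed (simp add: assms(2))
qed (rule assms(1))

lemma sublinear_add: "sublinear p \<Longrightarrow> p (x + y) \<le> p x + p y"
  by (simp add: sublinear_def)

lemma sublinear_scaleR: "sublinear p \<Longrightarrow> r \<ge> 0 \<Longrightarrow> p (r *\<^sub>R x) = r * p x"
  by (simp add: sublinear_def)

lemma sublinear_zero: "sublinear p \<Longrightarrow> p 0 = 0"
  using sublinear_scaleR[of p 0 0] by simp

lemma sublinear_neg: "sublinear p \<Longrightarrow> - p (- x) \<le> p x"
  using sublinear_add[of p x "- x"] sublinear_zero[of p] by simp

text \<open>The infimum of \<open>p (x + t *\<^sub>R y) - t * p y\<close> over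
  \<open>t \<ge> 0\<close> is the largest sublinear minorant of \<open>p\<close> with value at most
  \<open>- p y\<close> at \<open>- y\<close>. It serves twice: to fix the value at the point to be
  normed, and to show that a minimal functional is odd.\<close>

lemma sublinear_shift:
  assumes p: "sublinear p"
  obtains q where "sublinear q" "\<And>x. q x \<le> p x" "q (- y) \<le> - p y"
proof -
  define h where "h x t = p (x + t *\<^sub>R y) - t * p y" for x t
  define q where "q x = (INF t\<in>{0..}. h x t)" for x
  have bd: "bdd_below (h x ` {0..})" for x
  proof (rule bdd_belowI2)
    fix t :: real assume "t \<in> {0..}"
    hence "t * p y = p (t *\<^sub>R y)" using sublinear_scaleR[OF p] by simp
    also have "\<dots> \<le> p (x + t *\<^sub>R y) + p (- x)"
      using sublinear_add[OF p, of "x + t *\<^sub>R y" "- x"] by simp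
    finally show "- p (- x) \<le> h x t" by (simp add: h_def)
  qed
  have q_le: "q x \<le> h x t" if "t \<ge> 0" for x t
    unfolding q_def using bd that by (intro cINF_lower) auto
  have q_ge: "c \<le> q x" if "\<And>t. t \<ge> 0 \<Longrightarrow> c \<le> h x t" for c x
    unfolding q_def using that by (intro cINF_greatest) auto
  have "sublinear q"
  proof (rule sublinearI)
    fix x x'
    have "q (x + x') - h x t \<le> h x' t'" if "t \<ge> 0" "t' \<ge> 0" for t t'
    proof -
      have "q (x + x') \<le> h (x + x') (t + t')" using that by (intro q_le) simp
      also have "\<dots> \<le> h x t + h x' t'"
        using sublinear_add[OF p, of "x + t *\<^sub>R y" "x' + t' *\<^sub>R y"]
        by (simp add: h_def algebra_simps)
      finally show ?thesis by simp
    qed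
    hence "q (x + x') - h x t \<le> q x'" if "t \<ge> 0" for t using that by (intro q_ge)
    hence "q (x + x') - q x' \<le> h x t" if "t \<ge> 0" for t using that by (simp add: algebra_simps)
    from q_ge[OF this] show "q (x + x') \<le> q x + q x'" by (simp add: algebra_simps)
  next
    have "h 0 t = 0" if "t \<ge> 0" for t using sublinear_scaleR[OF p that] by (simp add: h_def)
    hence "q 0 = (INF t\<in>{0::real..}. 0)" unfolding q_def by (intro INF_cong) auto
    thus "q 0 = 0" by simp
  next
    fix r :: real and x assume r: "r > 0"
    have "q (r *\<^sub>R x) / r \<le> h x t" if "t \<ge> 0" for t
    proof -
      have "q (r *\<^sub>R x) \<le> h (r *\<^sub>R x) (r * t)" using that r by (intro q_le) simp
      also have "\<dots> = r * h x t"
        using sublinear_scaleR[OF p, of r "x + t *\<^sub>R y"] r by (simp add: h_def algebra_simps)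
      finally show ?thesis using r by (simp add: field_simps)
    qed
    from q_ge[OF this] show "q (r *\<^sub>R x) \<le> r * q x" using r by (simp add: field_simps)
  qed
  moreover have "q x \<le> p x" for x using q_le[of 0 x] by (simp add: h_def)
  moreover have "q (- y) \<le> - p y" using q_le[of 1 "- y"] sublinear_zero[OF p] by (simp add: h_def)
  ultimately show ?thesis by (rule that)
qed

text \<open>A pointwise minimal sublinear functional is linear, so no extension from subspaces is needed.\<close>

lemma sublinear_minimal_exists:
  fixes p :: "'a::real_vector \<Rightarrow> real"
  assumes p: "sublinear p"
  obtains m where "sublinear m" "\<And>x. m x \<le> p x"
    "\<And>q. sublinear q \<Longrightarrow> (\<And>x. q x \<le> m x) \<Longrightarrow> q = m"
proof -
  define S where "S = {q. sublinear q \<and> (\<forall>x. q x \<le> p x)}"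
  \<comment> \<open>The order is reversed: Zorn yields a maximal element, and a pointwise smallest
    functional is sought.\<close>
  define R where "R q q' \<longleftrightarrow> (\<forall>x. q' x \<le> q x)" for q q' :: "'a \<Rightarrow> real"
  have "partial_order_on S (relation_of R S)"
    by (rule partial_order_on_relation_ofI) (auto simp: R_def fun_eq_iff intro: order_trans antisym)
  moreover have "\<exists>u\<in>S. \<forall>a\<in>C. R a u" if C: "C \<in> Chains (relation_of R S)" for C
  proof (cases "C = {}")
    case True
    thus ?thesis using p by (auto simp: S_def)
  next
    case False
    have CS: "C \<subseteq> S" using Chains_relation_of[OF C] .
    have tot: "R a b \<or> R b a" if "a \<in> C" "b \<in> C" for a b
      using C that by (auto simp: Chains_def relation_of_def)
    define u where "u x = (INF a\<in>C. a x)" for x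
    have bd: "bdd_below ((\<lambda>a. a x) ` C)" for x
    proof (rule bdd_belowI2)
      fix a assume "a \<in> C"
      hence "sublinear a" "a (- x) \<le> p (- x)" using CS by (auto simp: S_def)
      thus "- p (- x) \<le> a x" using sublinear_neg[of a x] by linarith
    qed
    have u_le: "u x \<le> a x" if "a \<in> C" for a x unfolding u_def using bd that by (intro cINF_lower)
    have u_ge: "c \<le> u x" if "\<And>a. a \<in> C \<Longrightarrow> c \<le> a x" for c x
      unfolding u_def using that False by (intro cINF_greatest) auto
    have sl: "sublinear a" if "a \<in> C" for a using that CS by (auto simp: S_def)
    have "sublinear u"
    proof (rule sublinearI)
      fix x y
      have "u (x + y) - a x \<le> b y" if "a \<in> C" "b \<in> C" for a b
      proof -
        obtain c where c: "c \<in> C" "R a c" "R b c"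
          using tot[of a b] \<open>a \<in> C\<close> \<open>b \<in> C\<close> by (metis R_def order_refl)
        have "u (x + y) \<le> c x + c y"
          using u_le[OF c(1), of "x + y"] sublinear_add[OF sl[OF c(1)], of x y] by linarith
        also have "\<dots> \<le> a x + b y" using c by (auto simp: R_def intro: add_mono)
        finally show ?thesis by simp
      qed
      hence "u (x + y) - a x \<le> u y" if "a \<in> C" for a using that by (intro u_ge)
      hence *: "u (x + y) - u y \<le> a x" if "a \<in> C" for a using that by (simp add: algebra_simps)
      have "u (x + y) - u y \<le> u x" by (rule u_ge) (rule *)
      thus "u (x + y) \<le> u x + u y" by (simp add: algebra_simps)
    next
      have "u 0 = (INF a\<in>C. 0)" unfolding u_def using sl by (intro INF_cong) (auto simp: sublinear_zero)
      thus "u 0 = 0" using False by simp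
    next
      fix r :: real and x assume r: "r > 0"
      have "u (r *\<^sub>R x) / r \<le> a x" if "a \<in> C" for a
        using u_le[OF that, of "r *\<^sub>R x"] sublinear_scaleR[OF sl[OF that], of r x] r
        by (simp add: field_simps)
      from u_ge[OF this] show "u (r *\<^sub>R x) \<le> r * u x" using r by (simp add: field_simps)
    qed
    moreover have "u x \<le> p x" for x
    proof -
      obtain a where "a \<in> C" using False by blast
      moreover from this have "a x \<le> p x" using CS by (auto simp: S_def)
      ultimately show ?thesis using u_le[of a x] by linarith
    qed
    ultimately have "u \<in> S" by (simp add: S_def)
    thus ?thesis using u_le by (auto simp: R_def)
  qed
  ultimately obtain m where m: "m \<in> S" "\<forall>a\<in>S. R m a \<longrightarrow> a = m"
    using predicate_Zorn by blast
  show ?thesis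
  proof (rule that)
    fix q assume "sublinear q" "\<And>x. q x \<le> m x"
    moreover from this have "q \<in> S" using m(1) by (auto simp: S_def intro: order_trans)
    ultimately show "q = m" using m(2) by (auto simp: R_def)
  qed (use m(1) in \<open>auto simp: S_def\<close>)
qed

text \<open>A minimal \<open>m\<close> is odd, since otherwise \<open>sublinear_shift\<close> would
  produce something strictly smaller, and an odd sublinear functional is linear. Passing from
  \<open>p\<close> to \<open>p'\<close> first forces \<open>m (- x0) \<le> - p x0\<close>, hence
  equality at \<open>x0\<close>.\<close>

theorem Hahn_Banach_sublinear:
  fixes p :: "'a::real_vector \<Rightarrow> real"
  assumes p: "sublinear p"
  obtains L where "linear L" "\<And>x. L x \<le> p x" "L x0 = p x0"
proof -
  obtain p' where p': "sublinear p'" "\<And>x. p' x \<le> p x" "p' (- x0) \<le> - p x0"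
    using sublinear_shift[OF p] by metis
  obtain m where m: "sublinear m" "\<And>x. m x \<le> p' x"
    "\<And>q. sublinear q \<Longrightarrow> (\<And>x. q x \<le> m x) \<Longrightarrow> q = m"
    using sublinear_minimal_exists[OF p'(1)] by metis
  have neg: "m (- y) = - m y" for y
  proof -
    obtain q where "sublinear q" "\<And>x. q x \<le> m x" "q (- y) \<le> - m y"
      using sublinear_shift[OF m(1)] by metis
    with m(3) have "m (- y) \<le> - m y" by metis
    thus ?thesis using sublinear_neg[OF m(1), of y] by linarith
  qed
  have add: "m (x + y) = m x + m y" for x y
  proof (rule antisym)
    show "m x + m y \<le> m (x + y)"
      using sublinear_add[OF m(1), of "- x" "- y"] neg[of x] neg[of y] neg[of "x + y"] by simp
  qed (rule sublinear_add[OF m(1)])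
  have scale: "m (r *\<^sub>R x) = r * m x" for r x
  proof (cases "r \<ge> 0")
    case False
    thus ?thesis using sublinear_scaleR[OF m(1), of "- r" "- x"] neg[of x] by simp
  qed (rule sublinear_scaleR[OF m(1)])
  show ?thesis
  proof (rule that[of m])
    show "linear m" by (rule linearI) (auto simp: add scale)
    show "m x \<le> p x" for x using m(2) p'(2) by (rule order_trans)
    show "m x0 = p x0"
      using m(2)[of "- x0"] p'(3) neg[of x0] m(2)[of x0] p'(2)[of x0] by linarith
  qed
qed

subsection \<open>Convex combinations and cluster points\<close>

text \<open>The supremum \<open>d\<close> of \<open>D\<close> is the infimum over \<open>h\<close>
  of the supremum of \<open>h\<close> on \<open>A\<close>. Let \<open>h\<close> nearly attain it. A
  slight mixture of \<open>h\<close> with \<open>h'\<close> still reaches about \<open>d\<close> at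
  some \<open>w\<close>. As \<open>h' w\<close> is at most 1 and has small weight,
  \<open>h w\<close> is large there; as \<open>h w\<close> hardly exceeds \<open>d\<close>, so is
  \<open>h' w\<close>.\<close>

lemma mixture_refinement:
  fixes C :: "('w \<Rightarrow> real) set"
  assumes ne: "C \<noteq> {}"
    and bounds: "\<And>h w. h \<in> C \<Longrightarrow> w \<in> A \<Longrightarrow> 0 \<le> h w \<and> h w \<le> 1"
    and mix: "\<And>h h' t. h \<in> C \<Longrightarrow> h' \<in> C \<Longrightarrow> 0 \<le> t \<Longrightarrow> t \<le> 1 \<Longrightarrow>
      (\<lambda>w. (1 - t) * h w + t * h' w) \<in> C"
    and big: "\<And>h. h \<in> C \<Longrightarrow> \<exists>w\<in>A. c \<le> h w"
    and e: "0 < e" "e \<le> 1"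
  obtains h where "h \<in> C" "\<And>h'. h' \<in> C \<Longrightarrow> \<exists>w\<in>A. c - e \<le> h w \<and> c - e \<le> h' w"
proof -
  define D where "D = {d. \<forall>h\<in>C. \<exists>w\<in>A. d \<le> h w}"
  have "c \<in> D" using big by (auto simp: D_def)
  have bdd: "bdd_above D"
  proof (rule bdd_aboveI)
    fix d assume "d \<in> D"
    obtain h where "h \<in> C" using ne by blast
    with \<open>d \<in> D\<close> bounds show "d \<le> 1" by (force simp: D_def)
  qed
  define d where "d = Sup D"
  have "c \<le> d" unfolding d_def using \<open>c \<in> D\<close> bdd by (rule cSup_upper)
  \<comment> \<open>Quadratic in \<open>e\<close>, so that \<open>2 * e' = s * e\<close> for the
    weight \<open>s = e / 2\<close>: after division by \<open>s\<close> the loss for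
    \<open>h'\<close> is only \<open>e\<close>.\<close>
  define e' where "e' = e\<^sup>2 / 4"
  have "e' > 0" using e by (simp add: e'_def)
  have e'e: "e' \<le> e / 4" using e by (simp add: e'_def power2_eq_square mult_left_le_one_le)
  have "d + e' \<notin> D" using cSup_upper[OF _ bdd, of "d + e'"] \<open>e' > 0\<close> by (auto simp: d_def)
  then obtain h where h: "h \<in> C" "\<And>w. w \<in> A \<Longrightarrow> h w < d + e'" by (force simp: D_def)
  obtain d' where d': "d' \<in> D" "d - e' < d'"
    using less_cSupE[of "d - e'" D] \<open>c \<in> D\<close> \<open>e' > 0\<close> unfolding d_def by auto
  show ?thesis
  proof (rule that[OF h(1)])
    fix h' assume h': "h' \<in> C"
    define s where "s = e / 2"
    have s: "0 < s" "s \<le> 1 / 2" using e by (auto simp: s_def)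
    have "(\<lambda>w. (1 - s) * h w + s * h' w) \<in> C" using mix[OF h(1) h', of s] s by simp
    then obtain w where w: "w \<in> A" "d' \<le> (1 - s) * h w + s * h' w"
      using d'(1) by (auto simp: D_def)
    have b: "0 \<le> h w" "h w \<le> 1" "0 \<le> h' w" "h' w \<le> 1" using bounds h(1) h' w(1) by auto
    have "s * h' w \<le> s" using b s by (simp add: mult_left_le)
    moreover have "(1 - s) * h w \<le> h w" using b s by (simp add: mult_left_le_one_le)
    ultimately have 1: "d - e' - s < h w" using w(2) d'(2) by linarith
    have "(1 - s) * h w \<le> (1 - s) * (d + e')" using h(2)[OF w(1)] s by (intro mult_left_mono) auto
    hence "d - e' - (1 - s) * (d + e') < s * h' w" using w(2) d'(2) by linarith
    hence "s * d - 2 * e' + s * e' < s * h' w" by (simp add: algebra_simps)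
    moreover have "s * e' > 0" using s \<open>e' > 0\<close> by simp
    moreover have "2 * e' = s * e" by (simp add: e'_def s_def power2_eq_square)
    ultimately have "s * (d - e) < s * h' w" by (simp add: algebra_simps)
    hence "d - e < h' w" using s by simp
    thus "\<exists>w\<in>A. c - e \<le> h w \<and> c - e \<le> h' w"
      using 1 w(1) \<open>c \<le> d\<close> e'e e by (intro bexI[of _ w]) (auto simp: s_def)
  qed
qed

text \<open>
  Together with compactness this replaces the measure-theoretic fact that a bounded sequence of
  continuous functions tending to zero pointwise has convex combinations tending to zero uniformly.
  At each step \<open>h k\<close> is a nearly optimal mixture, which forces every further mixture to be large
  somewhere on the set where \<open>h k\<close> is large.
\<close>

lemma nested_mixtures:
  fixes C :: "nat \<Rightarrow> ('w \<Rightarrow> real) set"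
  assumes ne: "\<And>k. C k \<noteq> {}"
    and dec: "\<And>k. C (Suc k) \<subseteq> C k"
    and bounds: "\<And>k h w. h \<in> C k \<Longrightarrow> w \<in> A \<Longrightarrow> 0 \<le> h w \<and> h w \<le> 1"
    and mix: "\<And>k h h' t. h \<in> C k \<Longrightarrow> h' \<in> C k \<Longrightarrow> 0 \<le> t \<Longrightarrow> t \<le> 1 \<Longrightarrow>
      (\<lambda>w. (1 - t) * h w + t * h' w) \<in> C k"
    and big: "\<And>h. h \<in> C 0 \<Longrightarrow> \<exists>w\<in>A. c \<le> h w"
    and c: "0 < c"
  obtains h w where "\<And>k. h k \<in> C k" "\<And>m. w m \<in> A" "\<And>k m. k \<le> m \<Longrightarrow> c / 2 \<le> h k (w m)"
proof -
  have "c \<le> 1" using ne[of 0] big bounds by (metis all_not_in_conv order_trans)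
  \<comment> \<open>The losses sum to \<open>c / 2\<close>, so the levels \<open>d k\<close> fall
    from \<open>c\<close> towards \<open>c / 2\<close> and never below.\<close>
  define e where "e k = c / 2 ^ (k + 2)" for k
  have e: "0 < e k" "e k \<le> 1" for k
  proof -
    show "0 < e k" using c by (simp add: e_def)
    have "(1::real) \<le> 2 ^ (k + 2)" by (rule one_le_power) simp
    thus "e k \<le> 1" using \<open>c \<le> 1\<close> unfolding e_def by (subst divide_le_eq_1) auto
  qed
  define d where "d k = c / 2 + c / 2 ^ (k + 1)" for k
  have d_Suc: "d (Suc k) = d k - e k" for k
    by (simp add: d_def e_def field_simps)
  have d_ge: "c / 2 \<le> d k" for k using c by (simp add: d_def)
  \<comment> \<open>Invariant of the nested sets: no mixture of stage \<open>k\<close> stays below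
    the level \<open>d k\<close> on all of \<open>B\<close>.\<close>
  define Q where "Q k B \<longleftrightarrow> B \<subseteq> A \<and> (\<forall>h\<in>C k. \<exists>w\<in>B. d k \<le> h w)" for k B
  have step: "\<exists>h B'. h \<in> C k \<and> B' \<subseteq> B \<and> Q (Suc k) B' \<and> (\<forall>w\<in>B'. c / 2 \<le> h w)"
    if "Q k B" for k B
  proof -
    obtain h where h: "h \<in> C k" "\<And>h'. h' \<in> C k \<Longrightarrow> \<exists>w\<in>B. d k - e k \<le> h w \<and> d k - e k \<le> h' w"
    proof (rule mixture_refinement[of "C k" B "d k" "e k"])
      show "0 \<le> h w \<and> h w \<le> 1" if "h \<in> C k" "w \<in> B" for h w
        using bounds that \<open>Q k B\<close> by (auto simp: Q_def)
      show "\<exists>w\<in>B. d k \<le> h w" if "h \<in> C k" for h using \<open>Q k B\<close> that by (auto simp: Q_def)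
    qed (use ne mix e in auto)
    define B' where "B' = {w\<in>B. d (Suc k) \<le> h w}"
    have "Q (Suc k) B'" unfolding Q_def
    proof (intro conjI ballI)
      show "B' \<subseteq> A" using that by (auto simp: B'_def Q_def)
      fix h' assume "h' \<in> C (Suc k)"
      thus "\<exists>w\<in>B'. d (Suc k) \<le> h' w" using h(2)[of h'] dec by (auto simp: B'_def d_Suc)
    qed
    moreover have "\<forall>w\<in>B'. c / 2 \<le> h w" using d_ge[of "Suc k"] by (auto simp: B'_def)
    moreover have "B' \<subseteq> B" by (auto simp: B'_def)
    ultimately show ?thesis using h(1) by blast
  qed
  have Q0: "Q 0 A" using big by (auto simp: Q_def d_def)
  define nxt where "nxt k B = (SOME B'. \<exists>h. h \<in> C k \<and> B' \<subseteq> B \<and> Q (Suc k) B' \<and> (\<forall>w\<in>B'. c / 2 \<le> h w))" for k B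
  define B where "B = rec_nat A nxt"
  have nxt: "\<exists>h. h \<in> C k \<and> nxt k X \<subseteq> X \<and> Q (Suc k) (nxt k X) \<and> (\<forall>w\<in>nxt k X. c / 2 \<le> h w)"
    if "Q k X" for k X
    unfolding nxt_def by (rule someI_ex) (use step[OF that] in blast)
  have QB: "Q k (B k)" for k
  proof (induction k)
    case (Suc k)
    have "B (Suc k) = nxt k (B k)" by (simp add: B_def)
    thus ?case using nxt[OF Suc] by (elim exE) (simp only:)
  qed (simp add: B_def Q0)
  have "\<exists>h. h \<in> C k \<and> B (Suc k) \<subseteq> B k \<and> (\<forall>w\<in>B (Suc k). c / 2 \<le> h w)" for k
    using nxt[OF QB[of k]] by (auto simp: B_def)
  then obtain h where h: "\<And>k. h k \<in> C k" "\<And>k. B (Suc k) \<subseteq> B k"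
    "\<And>k w. w \<in> B (Suc k) \<Longrightarrow> c / 2 \<le> h k w" by metis
  have anti: "B m \<subseteq> B k" if "k \<le> m" for k m
    using lift_Suc_antimono_le[of B, OF h(2) that] .
  \<comment> \<open>A point of \<open>B (Suc m)\<close> lies in all earlier sets, so every
    \<open>h k\<close> with \<open>k \<le> m\<close> is large at it.\<close>
  have "\<exists>w. w \<in> B (Suc m)" for m
    using QB[of "Suc m"] ne[of "Suc m"] by (auto simp: Q_def)
  then obtain w where w: "\<And>m. w m \<in> B (Suc m)" by metis
  show ?thesis
  proof (rule that[of h w])
    show "w m \<in> A" for m using w[of m] QB[of "Suc m"] by (auto simp: Q_def)
    show "c / 2 \<le> h k (w m)" if "k \<le> m" for k m
      using h(3)[of "w m" k] w[of m] anti[of "Suc k" "Suc m"] that by auto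
  qed (rule h(1))
qed

text \<open>Tychonoff's theorem for the pointwise values. The index set will be a whole space of
  functionals or of vectors, so a filter finer than \<open>sequentially\<close> takes the place of a
  subsequence.\<close>

lemma bounded_family_cluster:
  fixes u :: "nat \<Rightarrow> 'i \<Rightarrow> 'k::heine_borel"
  assumes "\<And>i. bounded (range (\<lambda>n. u n i))"
  obtains G v where "G \<le> sequentially" "G \<noteq> bot" "\<And>i. ((\<lambda>n. u n i) \<longlongrightarrow> v i) G"
proof -
  define K where "K = (\<Pi>\<^sub>E i\<in>UNIV. closure (range (\<lambda>n. u n i)))"
  have "compactin (product_topology (\<lambda>i. euclidean) UNIV) K"
    unfolding K_def compactin_PiE using assms by (auto simp: compact_closure)
  hence "compact K" by (simp add: euclidean_product_topology)
  define F where "F = filtermap u sequentially"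
  have "F \<le> principal K" unfolding F_def K_def
    by (auto simp: le_principal eventually_filtermap PiE_iff
        intro!: always_eventually closure_subset[THEN subsetD])
  moreover have "F \<noteq> bot" by (simp add: F_def filtermap_bot_iff)
  ultimately obtain v where v: "inf (nhds v) F \<noteq> bot"
    using \<open>compact K\<close> unfolding compact_filter le_principal by blast
  \<comment> \<open>The neighbourhoods of the cluster point, pulled back along \<open>u\<close> to
    the indices; the filter is proper because \<open>v\<close> is a cluster point.\<close>
  define G where "G = inf sequentially (filtercomap u (nhds v))"
  have "G \<noteq> bot"
  proof
    assume "G = bot"
    hence "eventually (\<lambda>_. False) G" by simp
    then obtain P Q where PQ: "eventually P sequentially" "eventually Q (filtercomap u (nhds v))"
      "\<And>n. P n \<Longrightarrow> Q n \<Longrightarrow> False" unfolding G_def eventually_inf by blast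
    then obtain R where R: "eventually R (nhds v)" "\<And>n. R (u n) \<Longrightarrow> Q n"
      by (auto simp: eventually_filtercomap)
    have "eventually (\<lambda>x. \<not> R x) F" unfolding F_def eventually_filtermap
      using PQ(1) by (rule eventually_mono) (use PQ(3) R(2) in blast)
    hence "eventually (\<lambda>_. False) (inf (nhds v) F)"
      using R(1) unfolding eventually_inf by blast
    thus False using v by (simp add: trivial_limit_def)
  qed
  moreover have "((\<lambda>n. u n i) \<longlongrightarrow> v i) G" for i
  proof -
    have "(u \<longlongrightarrow> v) G" unfolding G_def filterlim_iff_le_filtercomap by simp
    thus ?thesis
      using continuous_on_tendsto_compose[OF continuous_on_product_coordinates, of u v G i] by simp
  qed
  ultimately show ?thesis using that[of G v] by (simp add: G_def)
qed

subsection \<open>Duality over the scalar field\<close>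

text \<open>
  The real functional \<open>\<lambda>c. c \<bullet> 1\<close> plays the role of the real part on the abstract scalar field
  \<open>'k\<close>: together with multiplication it gives a nondegenerate pairing.
\<close>

lemma inner_one_mult_separates:
  fixes u v :: "'k::{real_normed_field, euclidean_space}"
  assumes "\<And>c. (c * u) \<bullet> 1 = (c * v) \<bullet> 1"
  shows "u = v"
proof (rule ccontr)
  assume "u \<noteq> v"
  hence "(inverse (u - v) * u) \<bullet> 1 - (inverse (u - v) * v) \<bullet> 1 = (1::'k) \<bullet> 1"
    by (simp flip: inner_diff_left right_diff_distrib)
  thus False using assms[of "inverse (u - v)"] by simp
qed

lemma inner_one_le_norm: "c \<bullet> 1 \<le> norm (c::'k::{real_normed_field, euclidean_space})"
  using Cauchy_Schwarz_ineq2[of c 1] by simp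

lemma inner_one_of_real: "of_real r \<bullet> (1::'k::{real_normed_field, euclidean_space}) = r"
  by (simp add: of_real_def flip: power2_norm_eq_inner)

text \<open>Riesz representation for the pairing \<open>(c * u) \<bullet> 1\<close>.
  \<open>A\<close> collects the values of the pairing on \<open>Basis\<close>; nondegeneracy makes
  it injective, hence surjective by finite dimension.\<close>

lemma inner_one_representation:
  fixes L :: "'k::{real_normed_field, euclidean_space} \<Rightarrow> real"
  assumes "linear L"
  shows "\<exists>!u. \<forall>c. L c = (c * u) \<bullet> 1"
proof (rule ex_ex1I)
  define A where "A u = (\<Sum>b\<in>Basis. ((b * u) \<bullet> 1) *\<^sub>R b)" for u :: 'k
  have "linear A" unfolding A_def
    by (rule linearI) (simp_all add: algebra_simps inner_add_left sum.distrib scaleR_sum_right)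
  moreover have "inj A"
  proof (subst linear_injective_0[OF \<open>linear A\<close>], intro allI impI)
    fix u assume "A u = 0"
    have "(b * u) \<bullet> 1 = 0" if "b \<in> Basis" for b
    proof -
      have "A u \<bullet> b = (b * u) \<bullet> 1" using that unfolding A_def by simp
      thus ?thesis using \<open>A u = 0\<close> by simp
    qed
    hence "(c * u) \<bullet> 1 = 0" for c
      by (subst euclidean_representation[of c, symmetric])
        (simp add: sum_distrib_right inner_sum_left)
    from inner_one_mult_separates[of u 0] this show "u = 0" by simp
  qed
  ultimately have "surj A" by (rule linear_inj_imp_surj)
  then obtain u where u: "A u = (\<Sum>b\<in>Basis. L b *\<^sub>R b)" by (metis surjD)
  have b: "L b = (b * u) \<bullet> 1" if "b \<in> Basis" for b
    using arg_cong[OF u, of "\<lambda>x. x \<bullet> b"] that by (simp add: A_def)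
  have "L c = (c * u) \<bullet> 1" for c
  proof -
    have "L c = L (\<Sum>b\<in>Basis. (c \<bullet> b) *\<^sub>R b)" by (simp add: euclidean_representation)
    also have "\<dots> = (\<Sum>b\<in>Basis. (c \<bullet> b) * L b)"
      using assms by (simp add: linear_sum linear_scale)
    also have "\<dots> = (\<Sum>b\<in>Basis. (c \<bullet> b) *\<^sub>R ((b * u) \<bullet> 1))" using b by simp
    also have "\<dots> = ((\<Sum>b\<in>Basis. (c \<bullet> b) *\<^sub>R b) * u) \<bullet> 1"
      by (simp add: sum_distrib_right inner_sum_left)
    finally show ?thesis by (simp add: euclidean_representation)
  qed
  thus "\<exists>u. \<forall>c. L c = (c * u) \<bullet> 1" by blast
  show "u = v" if "\<forall>c. L c = (c * u) \<bullet> 1" "\<forall>c. L c = (c * v) \<bullet> 1" for u v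
    by (rule inner_one_mult_separates) (use that in simp)
qed

context banach_space_over
begin

lemma scl_scaleR_left: "scl (r *\<^sub>R c) x = r *\<^sub>R scl c x"
  by (simp add: scaleR_conv_of_real scale_of_real flip: scale_scale)

lemma scl_scaleR_right: "scl c (r *\<^sub>R x) = r *\<^sub>R scl c x"
  by (metis scale_of_real scale_left_commute)

lemma bounded_bilinear_scl: "bounded_bilinear scl"
  by unfold_locales
    (auto simp: scale_left_distrib scale_right_distrib scl_scaleR_left scl_scaleR_right norm_scale
      intro!: exI[of _ 1])

lemma dual_space_iff: "\<phi> \<in> dual_space scl \<longleftrightarrow> (\<forall>c x. \<phi> (scl c x) = c * \<phi> x)"
proof -
  have "vector_space ((*) :: 'k \<Rightarrow> 'k \<Rightarrow> 'k)" by unfold_locales (simp_all add: algebra_simps)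
  thus ?thesis unfolding dual_space_def Vector_Spaces.linear_iff
    by (auto simp: vector_space_axioms blinfun.add_right)
qed

lemma bounded_ops_iff: "T \<in> bounded_ops scl \<longleftrightarrow> (\<forall>c x. T (scl c x) = scl c (T x))"
  unfolding bounded_ops_def Vector_Spaces.linear_iff
  by (auto simp: vector_space_axioms blinfun.add_right)

lemma dual_space_mult: "\<phi> \<in> dual_space scl \<Longrightarrow> blinfun_mult_right c o\<^sub>L \<phi> \<in> dual_space scl"
  by (simp add: dual_space_iff algebra_simps)

lemma dual_space_scaleR: "\<phi> \<in> dual_space scl \<Longrightarrow> r *\<^sub>R \<phi> \<in> dual_space scl"
  by (simp add: dual_space_iff blinfun.scaleR_left algebra_simps)

lemma dual_space_compose: "\<phi> \<in> dual_space scl \<Longrightarrow> T \<in> bounded_ops scl \<Longrightarrow> \<phi> o\<^sub>L T \<in> dual_space scl"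
  by (simp add: dual_space_iff bounded_ops_iff)

lemma norm_mult_right_compose_le:
  "norm (blinfun_mult_right c o\<^sub>L (\<phi> :: 'e \<Rightarrow>\<^sub>L 'k)) \<le> norm c * norm \<phi>"
  by (rule norm_blinfun_bound) (auto simp: norm_mult mult.assoc intro!: mult_left_mono norm_blinfun)

text \<open>The \<open>'k\<close>-linear functional with real part \<open>g\<close>: its value at
  \<open>x\<close> is the scalar representing the map from \<open>c\<close> to
  \<open>g (scl c x)\<close>. For complex scalars this is the formula g(x) - i g(i x).\<close>

lemma dual_functional_of_real:
  assumes g: "linear g" and B: "\<And>x. g x \<le> B * norm x" and B0: "0 \<le> B"
  obtains \<phi> where "\<phi> \<in> dual_space scl" "\<And>x. \<phi> x \<bullet> 1 = g x" "norm \<phi> \<le> B"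
proof -
  have lin: "linear (\<lambda>c. g (scl c x))" for x
    by (rule linearI)
      (simp_all add: scale_left_distrib linear_add[OF g] scl_scaleR_left linear_scale[OF g])
  define f where "f x = (THE u. \<forall>c. g (scl c x) = (c * u) \<bullet> 1)" for x
  have f: "g (scl c x) = (c * f x) \<bullet> 1" for c x
    using theI'[OF inner_one_representation[OF lin[of x]]] unfolding f_def by blast
  have add: "f (x + y) = f x + f y" for x y
    by (rule inner_one_mult_separates)
      (simp add: distrib_left inner_add_left scale_right_distrib linear_add[OF g] flip: f)
  have scale: "f (scl d x) = d * f x" for d x
  proof (rule inner_one_mult_separates)
    fix c
    show "(c * f (scl d x)) \<bullet> 1 = (c * (d * f x)) \<bullet> 1"
      using f[of c "scl d x"] f[of "c * d" x] by (simp add: mult.assoc)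
  qed
  have bd: "norm (f x) \<le> B * norm x" for x
  proof (cases "f x = 0")
    case False
    \<comment> \<open>At a multiple of \<open>x\<close> where \<open>f\<close> has the value 1, the
      real part is the full absolute value, so the constant \<open>B\<close> survives.\<close>
    have "1 = (inverse (f x) * f x) \<bullet> 1" using False inner_one_of_real[of 1] by simp
    also have "\<dots> = g (scl (inverse (f x)) x)" by (rule f[symmetric])
    also have "\<dots> \<le> B * (norm x / norm (f x))"
      using B[of "scl (inverse (f x)) x"] by (simp add: norm_scale norm_inverse divide_inverse mult_ac)
    finally show ?thesis using False by (simp add: field_simps)
  next
    case True
    thus ?thesis using B[of x] B[of "- x"] linear_neg[OF g, of x] by simp
  qed
  have "bounded_linear f"
  proof (rule bounded_linear_intro)
    show "f (r *\<^sub>R x) = r *\<^sub>R f x" for r x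
      using scale[of "of_real r" x] by (simp add: scale_of_real scaleR_conv_of_real)
    show "norm (f x) \<le> norm x * B" for x using bd[of x] by (simp add: mult.commute)
  qed (rule add)
  hence ap: "blinfun_apply (Blinfun f) = f" by (rule bounded_linear_Blinfun_apply)
  show ?thesis
  proof (rule that[of "Blinfun f"])
    show "Blinfun f \<in> dual_space scl" by (simp add: dual_space_iff ap scale)
    show "Blinfun f x \<bullet> 1 = g x" for x using f[of 1 x] by (simp add: ap)
    show "norm (Blinfun f) \<le> B"
      using bd B0 by (intro norm_blinfun_bound) (auto simp: ap)
  qed
qed

lemma dual_norming:
  obtains \<phi> where "\<phi> \<in> dual_space scl" "norm \<phi> \<le> 1" "\<phi> x = of_real (norm x)"
proof -
  have "sublinear (norm :: 'e \<Rightarrow> real)" by (rule sublinearI) (auto intro: norm_triangle_ineq)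
  then obtain L :: "'e \<Rightarrow> real" where L: "linear L" "\<And>y. L y \<le> norm y" "L x = norm x"
    using Hahn_Banach_sublinear[of norm x] by metis
  obtain \<phi> where \<phi>: "\<phi> \<in> dual_space scl" "\<And>y. \<phi> y \<bullet> 1 = L y" "norm \<phi> \<le> 1"
    using dual_functional_of_real[OF L(1), of 1] L(2) by auto
  have "norm (\<phi> x) \<le> norm x" using norm_blinfun[of \<phi> x] \<phi>(3)
    by (metis mult_left_le_one_le norm_ge_zero order_trans)
  moreover have "norm x \<le> norm (\<phi> x)" using \<phi>(2)[of x] L(3) inner_one_le_norm[of "\<phi> x"] by simp
  ultimately have n: "norm (\<phi> x) = norm x" by simp
  show ?thesis
  proof (cases "x = 0")
    case True
    thus ?thesis using that[OF \<phi>(1,3)] by simp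
  next
    case False
    define c where "c = of_real (norm x) / \<phi> x"
    have c: "norm c = 1" "c * \<phi> x = of_real (norm x)" using False n by (auto simp: c_def norm_divide)
    show ?thesis
    proof (rule that[of "blinfun_mult_right c o\<^sub>L \<phi>"])
      show "norm (blinfun_mult_right c o\<^sub>L \<phi>) \<le> 1"
        using norm_mult_right_compose_le[of c \<phi>] c(1) \<phi>(3) by simp
    qed (use c \<phi>(1) in \<open>auto simp: dual_space_mult\<close>)
  qed
qed

lemma norm_le_dual:
  assumes "\<And>\<phi>. \<phi> \<in> dual_space scl \<Longrightarrow> norm \<phi> \<le> 1 \<Longrightarrow> norm (\<phi> x) \<le> b"
  shows "norm x \<le> b"
  by (rule dual_norming[of x]) (use assms in \<open>force\<close>)

lemma dual_separates:
  assumes "\<And>\<phi>. \<phi> \<in> dual_space scl \<Longrightarrow> \<phi> x = \<phi> y"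
  shows "x = y"
  using norm_le_dual[of "x - y" 0] assms by (simp add: blinfun.diff_right)

text \<open>Mazur's theorem for subspaces: the distance to \<open>S\<close> is sublinear, and a
  linear functional below it that agrees with it at \<open>y\<close> is at most 0 on
  \<open>S\<close> but positive at \<open>y\<close> if \<open>y\<close> lies outside.\<close>

lemma weakly_closed_subspace:
  fixes S :: "'e set"
  assumes S: "real_vector.subspace S" "closed S"
    and lim: "\<And>\<phi>. \<phi> \<in> dual_space scl \<Longrightarrow> ((\<lambda>n. \<phi> (u n)) \<longlongrightarrow> \<phi> y) G" "G \<noteq> bot"
    and mem: "\<And>n. u n \<in> S"
  shows "y \<in> S"
proof (rule ccontr)
  assume "y \<notin> S"
  have ne: "S \<noteq> {}" using mem by blast
  have app: "\<exists>s\<in>S. dist x s < infdist x S + e" if "e > 0" for x e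
    using that ne cINF_less_iff[of S "dist x" "infdist x S + e"] by (auto simp: infdist_notempty)
  have "sublinear (\<lambda>x. infdist x S)"
  proof (rule sublinearI)
    fix x x'
    show "infdist (x + x') S \<le> infdist x S + infdist x' S"
    proof (rule field_le_epsilon)
      fix e :: real assume "e > 0"
      obtain s where s: "s \<in> S" "dist x s < infdist x S + e / 2" using app[of "e/2" x] \<open>e > 0\<close> by auto
      obtain s' where s': "s' \<in> S" "dist x' s' < infdist x' S + e / 2" using app[of "e/2" x'] \<open>e > 0\<close> by auto
      have "infdist (x + x') S \<le> dist (x + x') (s + s')"
        using s s' S(1) by (intro infdist_le) (rule real_vector.subspace_add)
      also have "\<dots> \<le> dist x s + dist x' s'" by (rule dist_triangle_add)
      finally show "infdist (x + x') S \<le> infdist x S + infdist x' S + e" using s s' by linarith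
    qed
  next
    show "infdist 0 S = 0" using S(1) by (simp add: real_vector.subspace_0)
  next
    fix r :: real and x assume r: "r > 0"
    show "infdist (r *\<^sub>R x) S \<le> r * infdist x S"
    proof (rule field_le_epsilon)
      fix e :: real assume "e > 0"
      then obtain s where s: "s \<in> S" "dist x s < infdist x S + e / r"
        using app[of "e/r" x] r by auto
      have "infdist (r *\<^sub>R x) S \<le> dist (r *\<^sub>R x) (r *\<^sub>R s)"
        using s S(1) by (intro infdist_le) (rule real_vector.subspace_scale)
      also have "\<dots> = r * dist x s" using r by (simp add: dist_norm flip: scaleR_diff_right)
      also have "\<dots> \<le> r * (infdist x S + e / r)" using s r by simp
      finally show "infdist (r *\<^sub>R x) S \<le> r * infdist x S + e" using r by (simp add: distrib_left)
    qed
  qed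
  then obtain L where L: "linear L" "\<And>x. L x \<le> infdist x S" "L y = infdist y S"
    using Hahn_Banach_sublinear[of "\<lambda>x. infdist x S" y] by metis
  have "0 \<in> S" using S(1) by (rule real_vector.subspace_0)
  have "L x \<le> 1 * norm x" for x
    using L(2)[of x] infdist_le[OF \<open>0 \<in> S\<close>, of x] by simp
  from dual_functional_of_real[OF L(1) this zero_le_one]
  obtain \<phi> where \<phi>: "\<phi> \<in> dual_space scl" "\<And>x. \<phi> x \<bullet> 1 = L x" by metis
  have "L x \<le> 0" if "x \<in> S" for x using L(2)[of x] that by simp
  moreover have "((\<lambda>n. L (u n)) \<longlongrightarrow> L y) G"
    using tendsto_inner[OF lim(1)[OF \<phi>(1)] tendsto_const[of 1]] by (simp add: \<phi>(2))
  ultimately have "L y \<le> 0"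
    by (intro tendsto_upperbound[OF _ _ lim(2)]) (auto simp: mem)
  moreover have "0 < infdist y S"
    using \<open>y \<notin> S\<close> S(2) ne by (metis in_closed_iff_infdist_zero infdist_nonneg order_less_le)
  ultimately show False using L(3) by simp
qed

section \<open>Rank-one operators, finite tensors and the trace pairing\<close>

definition tens :: "'e \<Rightarrow> ('e \<Rightarrow>\<^sub>L 'k) \<Rightarrow> ('e \<Rightarrow>\<^sub>L 'e)" where
  "tens x \<phi> = Blinfun (\<lambda>y. scl (\<phi> y) x)"

lemma tens_apply [simp]: "tens x \<phi> y = scl (\<phi> y) x"
  unfolding tens_def
  by (subst bounded_linear_Blinfun_apply)
    (auto intro: bounded_bilinear.bounded_linear_left[OF bounded_bilinear_scl, THEN bounded_linear_compose]
      blinfun.bounded_linear_right)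

lemma norm_tens_le: "norm (tens x \<phi>) \<le> norm x * norm \<phi>"
proof (rule norm_blinfun_bound)
  fix y show "norm (tens x \<phi> y) \<le> norm x * norm \<phi> * norm y"
    using mult_right_mono[OF norm_blinfun[of \<phi> y], of "norm x"] by (simp add: norm_scale mult_ac)
qed simp

definition finite_tensor :: "('e \<times> ('e \<Rightarrow>\<^sub>L 'k)) list \<Rightarrow> ('e \<Rightarrow>\<^sub>L 'e)" where
  "finite_tensor us = (\<Sum>(x, \<phi>)\<leftarrow>us. tens x \<phi>)"

text \<open>For \<open>u = finite_tensor us\<close> this is the trace of \<open>V u\<close>, read
  off from the representing list. A bound by a multiple of \<open>norm (finite_tensor us)\<close>
  implies that it depends on \<open>u\<close> alone.\<close>

definition trace_pairing :: "('e \<Rightarrow>\<^sub>L 'e) \<Rightarrow> ('e \<times> ('e \<Rightarrow>\<^sub>L 'k)) list \<Rightarrow> 'k" where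
  "trace_pairing V us = (\<Sum>(x, \<phi>)\<leftarrow>us. \<phi> (V x))"

lemma finite_tensor_simps [simp]:
  "finite_tensor [] = 0"
  "finite_tensor ((x, \<phi>) # us) = tens x \<phi> + finite_tensor us"
  "finite_tensor (us @ vs) = finite_tensor us + finite_tensor vs"
  by (simp_all add: finite_tensor_def)

lemma trace_pairing_simps [simp]:
  "trace_pairing V [] = 0"
  "trace_pairing V ((x, \<phi>) # us) = \<phi> (V x) + trace_pairing V us"
  "trace_pairing V (us @ vs) = trace_pairing V us + trace_pairing V vs"
  by (simp_all add: trace_pairing_def)

lemma finite_tensor_bounded:
  "set us \<subseteq> UNIV \<times> dual_space scl \<Longrightarrow> finite_tensor us \<in> bounded_ops scl"
proof (induction us)
  case (Cons u us)
  thus ?case by (cases u)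
    (auto simp: bounded_ops_iff dual_space_iff blinfun.add_left scale_right_distrib)
qed (simp add: bounded_ops_iff)

text \<open>If \<open>P\<close> fixes \<open>B\<close>, then adding \<open>tens w \<psi>\<close>
  with \<open>w = b - P b\<close> fixes \<open>b\<close> as well, provided that
  \<open>\<psi>\<close> is 1 at \<open>b\<close> and 0 on \<open>B\<close>. Such a
  \<open>\<psi>\<close> arises from a functional norming \<open>w\<close>, composed with
  \<open>id_blinfun - P\<close> and rescaled.\<close>

lemma finite_tensor_identity_on_span:
  assumes "finite B"
  shows "\<exists>us. set us \<subseteq> UNIV \<times> dual_space scl \<and> (\<forall>b\<in>module.span scl B. finite_tensor us b = b)"
proof -
  have "\<exists>us. set us \<subseteq> UNIV \<times> dual_space scl \<and> (\<forall>b\<in>B. finite_tensor us b = b)"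
    using assms
  proof induction
    case empty
    show ?case by (rule exI[of _ "[]"]) simp
  next
    case (insert b B)
    then obtain us where us: "set us \<subseteq> UNIV \<times> dual_space scl" "\<And>b. b \<in> B \<Longrightarrow> finite_tensor us b = b"
      by blast
    define P where "P = finite_tensor us"
    define w where "w = b - P b"
    have Pb: "P \<in> bounded_ops scl" unfolding P_def by (rule finite_tensor_bounded[OF us(1)])
    show ?case
    proof (cases "w = 0")
      case True
      thus ?thesis using us by (intro exI[of _ us]) (auto simp: w_def P_def)
    next
      case False
      obtain \<phi> where \<phi>: "\<phi> \<in> dual_space scl" "\<phi> w = of_real (norm w)" by (rule dual_norming)
      define \<psi> where "\<psi> = blinfun_mult_right (1 / \<phi> w) o\<^sub>L (\<phi> o\<^sub>L (id_blinfun - P))"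
      have "\<psi> \<in> dual_space scl" unfolding \<psi>_def
        using \<phi>(1) Pb by (intro dual_space_mult dual_space_compose)
          (auto simp: bounded_ops_iff blinfun.diff_left scale_right_diff_distrib)
      moreover have "\<psi> b = 1" "\<And>b. b \<in> B \<Longrightarrow> \<psi> b = 0"
        using False \<phi>(2) us(2) by (auto simp: \<psi>_def blinfun.diff_left w_def P_def)
      ultimately show ?thesis using us
        by (intro exI[of _ "(w, \<psi>) # us"]) (auto simp: blinfun.add_left w_def P_def)
    qed
  qed
  then obtain us where us: "set us \<subseteq> UNIV \<times> dual_space scl" "\<And>b. b \<in> B \<Longrightarrow> finite_tensor us b = b"
    by blast
  have "finite_tensor us b = b" if "b \<in> module.span scl B" for b
    using that
  proof (induction rule: span_induct_alt)
    case (step c x y)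
    thus ?case using finite_tensor_bounded[OF us(1)] us(2)
      by (simp add: blinfun.add_right bounded_ops_iff)
  qed simp
  thus ?thesis using us(1) by blast
qed

lemma compose_finite_tensor:
  assumes "T \<in> bounded_ops scl"
  shows "finite_tensor us o\<^sub>L T = finite_tensor (map (\<lambda>(x, \<phi>). (x, \<phi> o\<^sub>L T)) us)"
    and "T o\<^sub>L finite_tensor us = finite_tensor (map (\<lambda>(x, \<phi>). (T x, \<phi>)) us)"
proof -
  note compose_add = bounded_bilinear.add_left[OF bounded_bilinear_blinfun_compose]
    bounded_bilinear.add_right[OF bounded_bilinear_blinfun_compose]
  have "tens x \<phi> o\<^sub>L T = tens x (\<phi> o\<^sub>L T)" for x \<phi> by (rule blinfun_eqI) simp
  thus "finite_tensor us o\<^sub>L T = finite_tensor (map (\<lambda>(x, \<phi>). (x, \<phi> o\<^sub>L T)) us)"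
    by (induction us) (auto simp: compose_add)
  have "T o\<^sub>L tens x \<phi> = tens (T x) \<phi>" for x \<phi>
    by (rule blinfun_eqI) (use assms in \<open>simp add: bounded_ops_iff\<close>)
  thus "T o\<^sub>L finite_tensor us = finite_tensor (map (\<lambda>(x, \<phi>). (T x, \<phi>)) us)"
    by (induction us) (auto simp: compose_add)
qed

lemma finite_rank_ops_finite_tensor:
  assumes "T \<in> finite_rank_ops scl"
  obtains us where "set us \<subseteq> UNIV \<times> dual_space scl" "T = finite_tensor us"
proof -
  from assms obtain B where B: "T \<in> bounded_ops scl" "finite B" "range T \<subseteq> module.span scl B"
    by (auto simp: finite_rank_ops_def)
  obtain us where us: "set us \<subseteq> UNIV \<times> dual_space scl"
    "\<And>b. b \<in> module.span scl B \<Longrightarrow> finite_tensor us b = b"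
    using finite_tensor_identity_on_span[OF B(2)] by blast
  have "T = finite_tensor us o\<^sub>L T" using us(2) B(3) by (intro blinfun_eqI) (simp add: range_subsetD)
  also have "\<dots> = finite_tensor (map (\<lambda>(x, \<phi>). (x, \<phi> o\<^sub>L T)) us)"
    by (rule compose_finite_tensor(1)[OF B(1)])
  finally show ?thesis using us(1) B(1) by (intro that) (auto intro: dual_space_compose)
qed

end

subsection \<open>Reflexivity and compactness\<close>

text \<open>The rational span of the sequence, with one vector adjoined at a time. Its countability
  reduces weak convergence to countably many norming functionals.\<close>

lemma countable_dense_in_closed_subspace:
  fixes u :: "nat \<Rightarrow> 'a::real_normed_vector"
  obtains D where "countable D" "range u \<subseteq> D" "subspace (closure D)"
proof -
  define D where "D = rec_nat {0} (\<lambda>n X. (\<lambda>(x, q). x + of_rat q *\<^sub>R u n) ` (X \<times> UNIV))"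
  have D0: "D 0 = {0}"
    and D_Suc: "D (Suc n) = (\<lambda>(x, q). x + of_rat q *\<^sub>R u n) ` (D n \<times> UNIV)" for n
    by (simp_all add: D_def)
  have D_SucI: "x + of_rat q *\<^sub>R u n \<in> D (Suc n)" if "x \<in> D n" for x q n
    unfolding D_Suc by (rule image_eqI[of _ _ "(x, q)"]) (use that in auto)
  have D_SucE: "\<exists>x' q. x' \<in> D n \<and> x = x' + of_rat q *\<^sub>R u n" if "x \<in> D (Suc n)" for x n
    using that unfolding D_Suc by auto
  have "countable (D n)" for n by (induction n) (auto simp: D0 D_Suc)
  hence cnt: "countable (\<Union>n. D n)" by auto
  have mono: "D m \<subseteq> D n" if "m \<le> n" for m n
  proof (rule lift_Suc_mono_le[OF _ that])
    show "D n \<subseteq> D (Suc n)" for n using D_SucI[where q = 0] by auto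
  qed
  have add: "x + y \<in> D n" if "x \<in> D n" "y \<in> D n" for x y n
    using that
  proof (induction n arbitrary: x y)
    case (Suc n)
    obtain x' q y' q' where *: "x' \<in> D n" "x = x' + of_rat q *\<^sub>R u n"
      "y' \<in> D n" "y = y' + of_rat q' *\<^sub>R u n"
      using D_SucE[OF Suc.prems(1)] D_SucE[OF Suc.prems(2)] by blast
    have "x + y = (x' + y') + of_rat (q + q') *\<^sub>R u n"
      using * by (simp add: of_rat_add algebra_simps)
    thus ?case using D_SucI[OF Suc.IH[OF *(1,3)], of "q + q'"] by simp
  qed (simp add: D0)
  have scale: "of_rat p *\<^sub>R x \<in> D n" if "x \<in> D n" for p x n
    using that
  proof (induction n arbitrary: x)
    case (Suc n)
    obtain x' q where *: "x' \<in> D n" "x = x' + of_rat q *\<^sub>R u n"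
      using D_SucE[OF Suc.prems] by blast
    have "of_rat p *\<^sub>R x = of_rat p *\<^sub>R x' + of_rat (p * q) *\<^sub>R u n"
      using * by (simp add: of_rat_mult algebra_simps)
    thus ?case using D_SucI[OF Suc.IH[OF *(1)], of "p * q"] by simp
  qed (simp add: D0)
  have zero: "0 \<in> D n" for n using mono[of 0 n] by (simp add: D0)
  define U where "U = (\<Union>n. D n)"
  have U_add: "x + y \<in> U" if "x \<in> U" "y \<in> U" for x y
  proof -
    from that obtain m n where "x \<in> D m" "y \<in> D n" unfolding U_def by blast
    hence "x \<in> D (max m n)" "y \<in> D (max m n)" 
      using mono[of m "max m n"] mono[of n "max m n"] by auto
    thus ?thesis using add by (auto simp: U_def)
  qed
  have U_scale: "of_rat p *\<^sub>R x \<in> U" if "x \<in> U" for p x using that scale by (auto simp: U_def)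
  have "u n \<in> U" for n using D_SucI[OF zero, where q = 1] by (auto simp: U_def)
  moreover have "subspace (closure U)"
  proof (rule subspaceI)
    show "0 \<in> closure U" using zero closure_subset[of U] by (auto simp: U_def)
  next
    fix x y assume "x \<in> closure U" "y \<in> closure U"
    then obtain X Y where "\<forall>n. X n \<in> U" "X \<longlonglongrightarrow> x" "\<forall>n. Y n \<in> U" "Y \<longlonglongrightarrow> y"
      by (auto simp: closure_sequential)
    thus "x + y \<in> closure U" unfolding closure_sequential
      by (intro exI[of _ "\<lambda>n. X n + Y n"]) (auto intro: U_add tendsto_add)
  next
    fix r :: real and x assume "x \<in> closure U"
    then obtain X where X: "\<forall>n. X n \<in> U" "X \<longlonglongrightarrow> x" by (auto simp: closure_sequential)
    have "r \<in> closure \<rat>" by (simp add: Rats_closure_real)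
    then obtain R where R: "\<forall>n. R n \<in> \<rat>" "R \<longlonglongrightarrow> r" by (auto simp: closure_sequential)
    have "R n *\<^sub>R X n \<in> U" for n using R(1) X(1) U_scale by (metis Rats_cases)
    thus "r *\<^sub>R x \<in> closure U" unfolding closure_sequential
      using X(2) R(2) by (intro exI[of _ "\<lambda>n. R n *\<^sub>R X n"]) (auto intro: tendsto_scaleR)
  qed
  ultimately show ?thesis using cnt by (intro that[of U]) (auto simp: U_def)
qed

lemma not_LIMSEQ_subseq:
  fixes X :: "nat \<Rightarrow> 'a::metric_space"
  assumes "\<not> X \<longlonglongrightarrow> l"
  obtains s :: "nat \<Rightarrow> nat" and e where "strict_mono s" "e > 0" "\<And>n. e \<le> dist (X (s n)) l"
proof -
  obtain e where e: "e > 0" "\<And>N. \<exists>n\<ge>N. e \<le> dist (X n) l"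
    using assms unfolding LIMSEQ_def by (meson not_le)
  hence "infinite {n. e \<le> dist (X n) l}"
    unfolding infinite_nat_iff_unbounded_le by auto
  from infinite_enumerate[OF this]
  obtain s :: "nat \<Rightarrow> nat" where s: "strict_mono s" "\<forall>n. s n \<in> {n. e \<le> dist (X n) l}" by blast
  show ?thesis by (rule that[OF s(1) e(1)]) (use s(2) in blast)
qed

context banach_space_over
begin

text \<open>Along a filter on which every functional converges, the limits form a member of the
  bidual; reflexivity represents it by a point.\<close>

lemma reflexive_weak_cluster:
  fixes u :: "nat \<Rightarrow> 'e"
  assumes refl: "reflexive_space scl" and bd: "bounded (range u)"
  obtains G y where "G \<le> sequentially" "G \<noteq> bot"
    "\<And>\<phi>. \<phi> \<in> dual_space scl \<Longrightarrow> ((\<lambda>n. \<phi> (u n)) \<longlongrightarrow> \<phi> y) G"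
proof -
  obtain B where B: "\<And>n. norm (u n) \<le> B" using bd by (auto simp: bounded_iff)
  have le: "norm (\<phi> (u n)) \<le> norm \<phi> * B" for \<phi> :: "'e \<Rightarrow>\<^sub>L 'k" and n
    using norm_blinfun[of \<phi> "u n"] mult_left_mono[OF B[of n], of "norm \<phi>"] by simp
  have "bounded (range (\<lambda>n. \<phi> (u n)))" for \<phi> :: "'e \<Rightarrow>\<^sub>L 'k"
    using le by (auto simp: bounded_iff)
  then obtain G and F :: "('e \<Rightarrow>\<^sub>L 'k) \<Rightarrow> 'k" where G: "G \<le> sequentially" "G \<noteq> bot"
    and F: "\<And>\<phi>. ((\<lambda>n. blinfun_apply \<phi> (u n)) \<longlongrightarrow> F \<phi>) G"
    using bounded_family_cluster[of "\<lambda>n \<phi>. blinfun_apply \<phi> (u n)"] by blast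
  have "F \<in> bidual_space scl" unfolding bidual_space_def
  proof (intro CollectI conjI ballI allI)
    show "F (\<phi> + \<psi>) = F \<phi> + F \<psi>" for \<phi> \<psi>
      using tendsto_add[OF F[of \<phi>] F[of \<psi>]] F[of "\<phi> + \<psi>"] G(2)
      by (simp add: blinfun.add_left tendsto_unique)
    show "F (blinfun_mult_right c o\<^sub>L \<phi>) = c * F \<phi>" for c \<phi>
      using tendsto_mult_left[OF F[of \<phi>], of c] F[of "blinfun_mult_right c o\<^sub>L \<phi>"] G(2)
      by (simp add: tendsto_unique)
    show "\<exists>C. \<forall>\<phi>\<in>dual_space scl. norm (F \<phi>) \<le> C * norm \<phi>"
      using tendsto_upperbound[OF tendsto_norm[OF F] always_eventually[OF allI[OF le]] G(2)]
      by (intro exI[of _ B]) (simp add: mult.commute)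
  qed
  then obtain y where "\<forall>\<phi>\<in>dual_space scl. F \<phi> = \<phi> y"
    using refl by (auto simp: reflexive_space_def)
  thus ?thesis using that[OF G, of y] F by metis
qed

text \<open>
  Along a subsequence countably many functionals that are total on the closed span converge; all weak
  cluster points then coincide.
\<close>

lemma reflexive_weak_subseq:
  fixes u :: "nat \<Rightarrow> 'e"
  assumes refl: "reflexive_space scl" and bd: "bounded (range u)"
  obtains r y where "strict_mono r" "\<And>\<phi>. \<phi> \<in> dual_space scl \<Longrightarrow> (\<lambda>n. \<phi> (u (r n))) \<longlonglongrightarrow> \<phi> y"
proof -
  obtain B where B: "\<And>n. norm (u n) \<le> B" using bd by (auto simp: bounded_iff)
  obtain D where D: "countable D" "range u \<subseteq> D" "real_vector.subspace (closure D)"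
    by (rule countable_dense_in_closed_subspace[of u])
  define d where "d = from_nat_into D"
  have range_d: "range d = D" unfolding d_def using D(1,2) by (intro range_from_nat_into) auto
  have "\<exists>\<phi>. \<phi> \<in> dual_space scl \<and> norm \<phi> \<le> 1 \<and> \<phi> (d k) = of_real (norm (d k))" for k
    using dual_norming[of "d k"] by metis
  then obtain f where f: "\<And>k. f k \<in> dual_space scl" "\<And>k. norm (f k) \<le> 1"
    "\<And>k. f k (d k) = of_real (norm (d k))" by metis
  \<comment> \<open>Functionals that norm a dense subset of \<open>closure D\<close> separate its
    points.\<close>
  have total: "y = y'" if y: "y \<in> closure D" "y' \<in> closure D" and eq: "\<And>k. f k y = f k y'" for y y'
  proof -
    have "norm (y - y') \<le> 0 + e" if "e > 0" for e
    proof -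
      have "y - y' \<in> closure D" using D(3) y by (rule real_vector.subspace_diff)
      then obtain k where k: "dist (d k) (y - y') < e / 2"
        using \<open>e > 0\<close> range_d unfolding closure_approachable by (metis half_gt_zero rangeE)
      have "norm (d k) = norm (f k (d k - (y - y')))"
        using f(3)[of k] eq[of k] by (simp add: blinfun.diff_right)
      also have "\<dots> \<le> norm (d k - (y - y'))"
        using norm_blinfun[of "f k" "d k - (y - y')"] f(2)[of k]
        by (metis mult_left_le_one_le norm_ge_zero order_trans)
      finally have "norm (d k) < e / 2" using k by (simp add: dist_norm)
      moreover have "norm (y - y') \<le> norm (d k) + norm (d k - (y - y'))"
        using norm_triangle_ineq4[of "d k" "d k - (y - y')"] by simp
      ultimately show ?thesis using k by (simp add: dist_norm)
    qed
    hence "norm (y - y') \<le> 0" by (rule field_le_epsilon)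
    thus ?thesis by simp
  qed
  have le: "norm (f k (u n)) \<le> B" for k n
    using norm_blinfun[of "f k" "u n"] f(2)[of k] B[of n]
    by (metis mult_left_le_one_le norm_ge_zero order_trans)
  define K where "K = (\<Pi>\<^sub>E k\<in>(UNIV :: nat set). cball (0 :: 'k) B)"
  have "compactin (product_topology (\<lambda>k. euclidean) UNIV) K"
    unfolding K_def compactin_PiE by auto
  \<comment> \<open>A countable product is metrizable, so compactness yields a genuine subsequence
    along which all \<open>f k\<close> converge.\<close>
  hence "seq_compact K" by (simp add: euclidean_product_topology compact_eq_seq_compact_metric)
  moreover have "\<forall>n. (\<lambda>k. f k (u n)) \<in> K" using le by (auto simp: K_def)
  ultimately obtain l r where r: "strict_mono r" "((\<lambda>n k. f k (u n)) \<circ> r) \<longlonglongrightarrow> l"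
    unfolding seq_compact_def by (elim allE[of _ "\<lambda>n k. f k (u n)"]) auto
  have l: "(\<lambda>n. f k (u (r n))) \<longlonglongrightarrow> l k" for k
    using continuous_on_tendsto_compose[OF continuous_on_product_coordinates[of k] r(2)]
    by (simp add: o_def)
  have cluster: "\<exists>G y. G \<le> sequentially \<and> G \<noteq> bot \<and> y \<in> closure D \<and> (\<forall>k. f k y = l k) \<and>
      (\<forall>\<phi>\<in>dual_space scl. ((\<lambda>n. \<phi> (u (r (s n)))) \<longlongrightarrow> \<phi> y) G)"
    if s: "strict_mono s" for s
  proof -
    have "bounded (range (u \<circ> r \<circ> s))" using bd by (rule bounded_subset) auto
    from reflexive_weak_cluster[OF refl this]
    obtain G y where G: "G \<le> sequentially" "G \<noteq> bot"
      "\<And>\<phi>. \<phi> \<in> dual_space scl \<Longrightarrow> ((\<lambda>n. \<phi> (u (r (s n)))) \<longlongrightarrow> \<phi> y) G"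
      by (auto simp: o_def)
    have "y \<in> closure D"
      using weakly_closed_subspace[OF D(3) closed_closure, of "\<lambda>n. u (r (s n))" y G]
        G(2,3) D(2) closure_subset[of D] by blast
    moreover have "f k y = l k" for k
    proof -
      have "(\<lambda>n. f k (u (r (s n)))) \<longlonglongrightarrow> l k"
        using LIMSEQ_subseq_LIMSEQ[OF l s] by (simp add: o_def)
      hence "((\<lambda>n. f k (u (r (s n)))) \<longlongrightarrow> l k) G" by (rule tendsto_mono[OF G(1)])
      thus ?thesis using tendsto_unique[OF G(2) G(3)[OF f(1)]] by blast
    qed
    ultimately show ?thesis using G by blast
  qed
  obtain y where y: "y \<in> closure D" "\<And>k. f k y = l k"
    using cluster[of id] by (auto simp: strict_mono_def)
  show ?thesis
  \<comment> \<open>If some functional failed to converge to its value at \<open>y\<close>, a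
    further subsequence would keep its distance. Its weak cluster point \<open>y'\<close> takes the
    same values \<open>l k\<close>, hence equals \<open>y\<close>, which is absurd.\<close>
  proof (rule that[OF r(1), of y], rule ccontr)
    fix \<phi> assume \<phi>: "\<phi> \<in> dual_space scl" and nl: "\<not> (\<lambda>n. \<phi> (u (r n))) \<longlonglongrightarrow> \<phi> y"
    obtain s :: "nat \<Rightarrow> nat" and e where s: "strict_mono s" "e > 0" "\<And>n. e \<le> dist (\<phi> (u (r (s n)))) (\<phi> y)"
      by (rule not_LIMSEQ_subseq[OF nl]) blast
    obtain G' y' where G': "G' \<noteq> bot" "y' \<in> closure D" "\<forall>k. f k y' = l k"
      "((\<lambda>n. \<phi> (u (r (s n)))) \<longlongrightarrow> \<phi> y') G'"
      using cluster[OF s(1)] \<phi> by blast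
    have "y = y'" by (rule total) (use y G' in auto)
    hence "\<forall>\<^sub>F n in G'. dist (\<phi> (u (r (s n)))) (\<phi> y) < e" using tendstoD[OF G'(4) s(2)] by simp
    hence "\<forall>\<^sub>F n in G'. False" by (rule eventually_mono) (use s(3) leD in blast)
    thus False using G'(1) by simp
  qed
qed

section \<open>Bounded trace functionals: weak convergence becomes norm convergence\<close>

text \<open>Pairing with \<open>y\<close> and \<open>w\<close> bounds the operator norm by the weak
  sum of the weighted points, because \<open>f n y\<close> has norm at most \<open>norm y\<close>.
  When \<open>f n\<close> norms \<open>V (z n)\<close>, the trace of the same tensor is the strong
  sum, so a trace condition compares the two.\<close>

lemma norm_sum_tens_le:
  assumes dual: "\<And>n. n < m \<Longrightarrow> f n \<in> dual_space scl \<and> norm (f n) \<le> 1"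
    and nonneg: "\<And>n. n < m \<Longrightarrow> 0 \<le> \<mu> n" "0 \<le> c"
    and small: "\<And>w. w \<in> dual_space scl \<Longrightarrow> norm w \<le> 1 \<Longrightarrow> (\<Sum>n<m. \<mu> n * norm (w (z n))) \<le> c"
  shows "norm (\<Sum>n<m. tens (\<mu> n *\<^sub>R z n) (f n)) \<le> c"
proof (rule norm_blinfun_bound[OF nonneg(2)])
  fix y
  show "norm ((\<Sum>n<m. tens (\<mu> n *\<^sub>R z n) (f n)) y) \<le> c * norm y"
  proof (rule norm_le_dual)
    fix w assume w: "w \<in> dual_space scl" "norm w \<le> 1"
    have "norm (w ((\<Sum>n<m. tens (\<mu> n *\<^sub>R z n) (f n)) y)) = norm (\<Sum>n<m. f n y * (\<mu> n *\<^sub>R w (z n)))"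
      using w(1) by (simp add: blinfun.sum_left blinfun.sum_right dual_space_iff blinfun.scaleR_right)
    also have "\<dots> \<le> (\<Sum>n<m. norm (f n y * (\<mu> n *\<^sub>R w (z n))))" by (rule norm_sum)
    also have "\<dots> \<le> (\<Sum>n<m. norm y * (\<mu> n * norm (w (z n))))"
    proof (rule sum_mono)
      fix n assume n: "n \<in> {..<m}"
      have "norm (f n y) \<le> norm y"
        using norm_blinfun[of "f n" y] dual[of n] n
        by (metis lessThan_iff mult_left_le_one_le norm_ge_zero order_trans)
      thus "norm (f n y * (\<mu> n *\<^sub>R w (z n))) \<le> norm y * (\<mu> n * norm (w (z n)))"
        using mult_right_mono[OF _ mult_nonneg_nonneg[OF nonneg(1)[of n] norm_ge_zero[of "w (z n)"]],
            of "norm (f n y)" "norm y"] n nonneg(1)[of n] by (simp add: norm_mult mult_ac)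
    qed
    also have "\<dots> = norm y * (\<Sum>n<m. \<mu> n * norm (w (z n)))" by (simp add: sum_distrib_left)
    also have "\<dots> \<le> norm y * c" using small[OF w] by (rule mult_left_mono) simp
    finally show "norm (w ((\<Sum>n<m. tens (\<mu> n *\<^sub>R z n) (f n)) y)) \<le> c * norm y"
      by (simp add: mult.commute)
  qed
qed

text \<open>The Alaoglu theorem in terms of cluster points: linearity and the norm bound pass to
  pointwise limits.\<close>

lemma dual_ball_cluster:
  fixes w :: "nat \<Rightarrow> ('e \<Rightarrow>\<^sub>L 'k)"
  assumes w: "\<And>m. w m \<in> dual_space scl" "\<And>m. norm (w m) \<le> 1"
  obtains G \<phi> where "G \<le> sequentially" "G \<noteq> bot" "\<phi> \<in> dual_space scl" "norm \<phi> \<le> 1"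
    "\<And>x. ((\<lambda>m. w m x) \<longlongrightarrow> \<phi> x) G"
proof -
  have le: "norm (w m x) \<le> norm x" for m x
    using norm_blinfun[of "w m" x] w(2)[of m]
    by (metis mult_left_le_one_le norm_ge_zero order_trans)
  have "bounded (range (\<lambda>m. w m x))" for x using le by (auto simp: bounded_iff)
  then obtain G v where G: "G \<le> sequentially" "G \<noteq> bot" and v: "\<And>x. ((\<lambda>m. w m x) \<longlongrightarrow> v x) G"
    using bounded_family_cluster[of "\<lambda>m x. blinfun_apply (w m) x"] by blast
  have bd: "norm (v x) \<le> norm x" for x
    using tendsto_upperbound[OF tendsto_norm[OF v] always_eventually[OF allI[OF le]] G(2)] .
  have "bounded_linear v"
  proof (rule bounded_linear_intro)
    show "v (x + y) = v x + v y" for x y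
      using tendsto_add[OF v[of x] v[of y]] v[of "x + y"] G(2)
      by (simp add: blinfun.add_right tendsto_unique)
    show "v (r *\<^sub>R x) = r *\<^sub>R v x" for r x
      using tendsto_scaleR[OF tendsto_const[of r] v[of x]] v[of "r *\<^sub>R x"] G(2)
      by (simp add: blinfun.scaleR_right tendsto_unique)
    show "norm (v x) \<le> norm x * 1" for x using bd by simp
  qed
  hence ap: "blinfun_apply (Blinfun v) = v" by (rule bounded_linear_Blinfun_apply)
  show ?thesis
  proof (rule that[OF G, of "Blinfun v"])
    have "v (scl c x) = c * v x" for c x
      using tendsto_mult_left[OF v[of x], of c] v[of "scl c x"] G(2) w(1)
      by (simp add: dual_space_iff tendsto_unique)
    thus "Blinfun v \<in> dual_space scl" by (simp add: dual_space_iff ap)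
    show "norm (Blinfun v) \<le> 1" using bd by (intro norm_blinfun_bound) (auto simp: ap)
    show "((\<lambda>m. w m x) \<longlongrightarrow> Blinfun v x) G" for x using v by (simp add: ap)
  qed
qed

text \<open>
  The trace condition makes \<open>V\<close> absolutely summing, as one sees by testing it on
  \<open>\<Sum>\<^sub>n \<mu>\<^sub>n z\<^sub>n \<otimes> f\<^sub>n\<close> with \<open>f\<^sub>n\<close> norming \<open>V z\<^sub>n\<close>.
\<close>

lemma trace_bounded_weakly_null:
  assumes M: "\<And>us. set us \<subseteq> UNIV \<times> dual_space scl \<Longrightarrow>
      norm (trace_pairing V us) \<le> M * norm (finite_tensor us)"
    and z: "\<And>n. norm (z n) \<le> 1" "\<And>\<phi>. \<phi> \<in> dual_space scl \<Longrightarrow> (\<lambda>n. \<phi> (z n)) \<longlonglongrightarrow> 0"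
    and \<delta>: "\<delta> > 0" "\<And>n. \<delta> \<le> norm (V (z n))"
  shows False
proof -
  define W where "W = {w \<in> dual_space scl. norm w \<le> 1}"
  define N where "N = max M 0"
  \<comment> \<open>Chosen so that \<open>M * c < \<delta>\<close>; replacing \<open>M\<close> by
    its positive part \<open>N\<close> keeps the denominator positive.\<close>
  define c where "c = \<delta> / (N + 1)"
  have "N \<ge> 0" and "M \<le> N" by (auto simp: N_def)
  have "c > 0" using \<delta>(1) \<open>N \<ge> 0\<close> by (simp add: c_def)
  \<comment> \<open>Probability weights supported in the indices from \<open>k\<close> up to below
    \<open>m\<close>. Enlarging \<open>m\<close> changes nothing, which gives two mixtures a common
    length.\<close>
  define P where "P k m \<mu> \<longleftrightarrow> (\<forall>n. 0 \<le> \<mu> n) \<and> (\<forall>n. n < k \<or> m \<le> n \<longrightarrow> \<mu> n = 0) \<and> (\<Sum>n<m. \<mu> n) = 1"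
    for k m and \<mu> :: "nat \<Rightarrow> real"
  define H where "H m \<mu> w = (\<Sum>n<m. \<mu> n * norm (blinfun_apply w (z n)))"
    for m and \<mu> :: "nat \<Rightarrow> real" and w :: "'e \<Rightarrow>\<^sub>L 'k"
  define C where "C k = {H m \<mu> |m \<mu>. P k m \<mu>}" for k
  have wz: "norm (w (z n)) \<le> 1" if "w \<in> W" for w n
  proof -
    have "norm w * norm (z n) \<le> 1" using that z(1)[of n] by (intro mult_le_one) (auto simp: W_def)
    thus ?thesis using norm_blinfun[of w "z n"] by linarith
  qed
  have extend: "P k m' \<mu> \<and> H m' \<mu> = H m \<mu>" if "P k m \<mu>" "m \<le> m'" for k m m' \<mu>
  proof -
    have 0: "\<mu> n = 0" if "n \<in> {..<m'} - {..<m}" for n using \<open>P k m \<mu>\<close> that by (auto simp: P_def)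
    have "(\<Sum>n<m'. \<mu> n) = (\<Sum>n<m. \<mu> n)" using 0 that(2) by (intro sum.mono_neutral_right) auto
    moreover have "H m' \<mu> w = H m \<mu> w" for w unfolding H_def
      using 0 that(2) by (intro sum.mono_neutral_right) auto
    ultimately show ?thesis using that by (auto simp: P_def fun_eq_iff)
  qed
  obtain h w where h: "\<And>k. h k \<in> C k" and w: "\<And>m. w m \<in> W"
    and hw: "\<And>k m. k \<le> m \<Longrightarrow> c / 2 \<le> h k (w m)"
  proof (rule nested_mixtures[of C W c])
    fix k
    have "(\<Sum>n<Suc k. if n = k then 1 else 0 :: real) = 1" by simp
    hence "P k (Suc k) (\<lambda>n. if n = k then 1 else 0)" by (auto simp: P_def)
    thus "C k \<noteq> {}" by (auto simp: C_def)
    show "C (Suc k) \<subseteq> C k" 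
    proof -
      have "P k m \<mu>" if "P (Suc k) m \<mu>" for m \<mu> using that by (simp add: P_def)
      thus ?thesis unfolding C_def by blast
    qed
  next
    fix k h w assume "h \<in> C k" "w \<in> W"
    then obtain m \<mu> where \<mu>: "P k m \<mu>" "h = H m \<mu>" by (auto simp: C_def)
    have "H m \<mu> w \<le> (\<Sum>n<m. \<mu> n)" unfolding H_def
      using \<mu>(1) wz[OF \<open>w \<in> W\<close>] by (intro sum_mono) (auto simp: P_def intro!: mult_left_le)
    moreover have "0 \<le> H m \<mu> w" unfolding H_def
      using \<mu>(1) by (intro sum_nonneg) (auto simp: P_def)
    ultimately show "0 \<le> h w \<and> h w \<le> 1" using \<mu> by (auto simp: P_def)
  next
    fix k h h' and t :: real assume hh: "h \<in> C k" "h' \<in> C k" and t: "0 \<le> t" "t \<le> 1"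
    then obtain m1 \<mu>1 m2 \<mu>2 where 1: "P k m1 \<mu>1" "h = H m1 \<mu>1" and 2: "P k m2 \<mu>2" "h' = H m2 \<mu>2"
      by (auto simp: C_def)
    define m where "m = max m1 m2"
    have 1: "P k m \<mu>1" "h = H m \<mu>1" using extend[OF 1(1), of m] 1(2) by (auto simp: m_def)
    have 2: "P k m \<mu>2" "h' = H m \<mu>2" using extend[OF 2(1), of m] 2(2) by (auto simp: m_def)
    have "P k m (\<lambda>n. (1 - t) * \<mu>1 n + t * \<mu>2 n)"
      using 1(1) 2(1) t by (auto simp: P_def sum.distrib simp flip: sum_distrib_left)
    moreover have "H m (\<lambda>n. (1 - t) * \<mu>1 n + t * \<mu>2 n) = (\<lambda>w. (1 - t) * h w + t * h' w)"
      unfolding 1 2 H_def by (simp add: fun_eq_iff sum.distrib sum_subtractf sum_distrib_left algebra_simps)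
    ultimately show "(\<lambda>w. (1 - t) * h w + t * h' w) \<in> C k" unfolding C_def
      by (intro CollectI exI[of _ m] exI[of _ "\<lambda>n. (1 - t) * \<mu>1 n + t * \<mu>2 n"]) simp
  next
    fix h assume "h \<in> C 0"
    then obtain m \<mu> where \<mu>: "P 0 m \<mu>" "h = H m \<mu>" by (auto simp: C_def)
    show "\<exists>w\<in>W. c \<le> h w"
    proof (rule ccontr)
      assume "\<not> ?thesis"
      hence small: "H m \<mu> w < c" if "w \<in> W" for w using that \<mu>(2) by force
      have "\<exists>\<phi>. \<phi> \<in> dual_space scl \<and> norm \<phi> \<le> 1 \<and> \<phi> (V (z n)) = of_real (norm (V (z n)))" for n
        using dual_norming[of "V (z n)"] by metis
      then obtain f where f: "\<And>n. f n \<in> dual_space scl" "\<And>n. norm (f n) \<le> 1"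
        "\<And>n. f n (V (z n)) = of_real (norm (V (z n)))" by metis
      \<comment> \<open>If a mixture stayed below \<open>c\<close> on the dual ball, this tensor
        would have operator norm at most \<open>c\<close>, whereas its trace against
        \<open>V\<close> averages the numbers \<open>norm (V (z n))\<close> and is at least
        \<open>\<delta>\<close>.\<close>
      define us where "us = map (\<lambda>n. (\<mu> n *\<^sub>R z n, f n)) [0..<m]"
      have us: "set us \<subseteq> UNIV \<times> dual_space scl" using f(1) by (auto simp: us_def)
      have "finite_tensor us = (\<Sum>n<m. tens (\<mu> n *\<^sub>R z n) (f n))"
        by (simp add: us_def finite_tensor_def o_def interv_sum_list_conv_sum_set_nat lessThan_atLeast0)
      also have "norm \<dots> \<le> c"
      proof (rule norm_sum_tens_le)
        show "(\<Sum>n<m. \<mu> n * norm (w (z n))) \<le> c" if "w \<in> dual_space scl" "norm w \<le> 1" for w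
          using small[of w] that by (auto simp: W_def H_def)
      qed (use f \<mu>(1) \<open>c > 0\<close> in \<open>auto simp: P_def\<close>)
      finally have fin: "norm (finite_tensor us) \<le> c" .
      have tr: "trace_pairing V us = of_real (\<Sum>n<m. \<mu> n * norm (V (z n)))"
        by (simp add: us_def trace_pairing_def o_def interv_sum_list_conv_sum_set_nat lessThan_atLeast0
            blinfun.scaleR_right f(3) scaleR_conv_of_real)
      have "\<delta> = (\<Sum>n<m. \<mu> n * \<delta>)" using \<mu>(1) by (simp add: P_def flip: sum_distrib_right)
      also have "\<dots> \<le> (\<Sum>n<m. \<mu> n * norm (V (z n)))"
        using \<delta>(2) \<mu>(1) by (intro sum_mono mult_left_mono) (auto simp: P_def)
      also have "\<dots> \<le> norm (trace_pairing V us)" unfolding tr norm_of_real by simp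
      also have "\<dots> \<le> M * norm (finite_tensor us)" by (rule M[OF us])
      also have "\<dots> \<le> N * c" using fin \<open>M \<le> N\<close> \<open>N \<ge> 0\<close> by (intro mult_mono) auto
      also have "\<dots> < (N + 1) * c" using \<open>c > 0\<close> by simp
      also have "\<dots> = \<delta>" using \<open>N \<ge> 0\<close> by (simp add: c_def)
      finally show False by simp
    qed
  qed (use \<open>c > 0\<close> in auto)
  \<comment> \<open>A weak-star cluster point of the \<open>w m\<close> inherits the lower bound for
    every \<open>h k\<close>, a finite sum of evaluations. But the weights of \<open>h k\<close>
    start at \<open>k\<close>, where \<open>\<phi> (z n)\<close> is already small.\<close>
  obtain G \<phi> where G: "G \<le> sequentially" "G \<noteq> bot" and \<phi>: "\<phi> \<in> dual_space scl" "norm \<phi> \<le> 1"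
    and lim: "\<And>x. ((\<lambda>m. w m x) \<longlongrightarrow> \<phi> x) G"
    using dual_ball_cluster[of w] w by (auto simp: W_def)
  have h_\<phi>: "c / 2 \<le> h k \<phi>" for k
  proof -
    obtain m \<mu> where \<mu>: "h k = H m \<mu>" using h[of k] by (auto simp: C_def)
    have "((\<lambda>j. h k (w j)) \<longlongrightarrow> h k \<phi>) G"
      unfolding \<mu> H_def by (intro tendsto_sum tendsto_mult_left tendsto_norm lim)
    moreover have "\<forall>\<^sub>F j in sequentially. c / 2 \<le> h k (w j)"
      using eventually_ge_at_top[of k] by eventually_elim (rule hw)
    hence "\<forall>\<^sub>F j in G. c / 2 \<le> h k (w j)" using G(1) by (simp add: filter_leD)
    ultimately show ?thesis by (rule tendsto_lowerbound[OF _ _ G(2)])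
  qed
  have "\<forall>\<^sub>F n in sequentially. dist (\<phi> (z n)) 0 < c / 4"
    using z(2)[OF \<phi>(1)] \<open>c > 0\<close> by (intro tendstoD) auto
  then obtain k where k: "\<And>n. k \<le> n \<Longrightarrow> norm (\<phi> (z n)) < c / 4"
    by (auto simp: eventually_sequentially)
  obtain m \<mu> where \<mu>: "P k m \<mu>" "h k = H m \<mu>" using h[of k] by (auto simp: C_def)
  have "H m \<mu> \<phi> \<le> (\<Sum>n<m. \<mu> n * (c / 4))" unfolding H_def
  proof (rule sum_mono)
    fix n assume "n \<in> {..<m}"
    show "\<mu> n * norm (\<phi> (z n)) \<le> \<mu> n * (c / 4)"
      using mult_left_mono[OF less_imp_le[OF k[of n]], of "\<mu> n"] \<mu>(1)
      by (cases "n < k") (simp_all add: P_def)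
  qed
  also have "\<dots> = c / 4" using \<mu>(1) by (simp add: P_def flip: sum_distrib_right sum_divide_distrib)
  finally show False using h_\<phi>[of k] \<mu>(2) \<open>c > 0\<close> by simp
qed

text \<open>By reflexivity bounded sequences have weakly convergent subsequences, and
  \<open>trace_bounded_weakly_null\<close> makes their images converge in norm.\<close>

lemma trace_bounded_compact:
  assumes refl: "reflexive_space scl" and V: "V \<in> bounded_ops scl"
    and M: "\<And>us. set us \<subseteq> UNIV \<times> dual_space scl \<Longrightarrow>
      norm (trace_pairing V us) \<le> M * norm (finite_tensor us)"
  shows "V \<in> compact_ops scl"
proof -
  define K where "K = closure (V ` cball 0 1)"
  have "seq_compact K"
    unfolding seq_compact_def
  proof (intro allI impI)
    fix s :: "nat \<Rightarrow> 'e" assume s: "\<forall>n. s n \<in> K"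
    have "\<exists>y. norm y \<le> 1 \<and> dist (V y) (s n) < inverse (real (Suc n))" for n
    proof -
      have "s n \<in> closure (V ` cball 0 1)" using s by (simp add: K_def)
      moreover have "0 < inverse (real (Suc n))" by simp
      ultimately obtain v where "v \<in> V ` cball 0 1" "dist v (s n) < inverse (real (Suc n))"
        unfolding closure_approachable by blast
      thus ?thesis by auto
    qed
    then obtain y where y: "\<And>n. norm (y n) \<le> 1" "\<And>n. dist (V (y n)) (s n) < inverse (real (Suc n))"
      by metis
    have "bounded (range y)" using y(1) by (auto simp: bounded_iff)
    from reflexive_weak_subseq[OF refl this]
    obtain r x where r: "strict_mono r" and x: "\<And>\<phi>. \<phi> \<in> dual_space scl \<Longrightarrow> (\<lambda>n. \<phi> (y (r n))) \<longlonglongrightarrow> \<phi> x"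
      by metis
    have Vlim: "(\<lambda>n. V (y (r n))) \<longlonglongrightarrow> V x"
    proof (rule ccontr)
      assume nl: "\<not> ?thesis"
      obtain t :: "nat \<Rightarrow> nat" and e where t: "strict_mono t" "e > 0" "\<And>n. e \<le> dist (V (y (r (t n)))) (V x)"
        by (rule not_LIMSEQ_subseq[OF nl]) blast
      \<comment> \<open>This factor brings the differences from the weak limit into the unit
        ball.\<close>
      define a where "a = 1 / (1 + norm x)"
      have a: "a > 0" unfolding a_def by (intro divide_pos_pos add_pos_nonneg) auto
      define z where "z n = a *\<^sub>R (y (r (t n)) - x)" for n
      show False
      proof (rule trace_bounded_weakly_null[OF M, of z "a * e"])
        fix n
        have "norm (y (r (t n)) - x) \<le> 1 + norm x"
          using norm_triangle_ineq4[of "y (r (t n))" x] y(1)[of "r (t n)"] by linarith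
        hence "norm (z n) \<le> a * (1 + norm x)" using a by (simp add: z_def)
        also have "\<dots> = 1" using add_pos_nonneg[OF zero_less_one norm_ge_zero[of x]] by (simp add: a_def)
        finally show "norm (z n) \<le> 1" .
        show "a * e \<le> norm (V (z n))" using t(3)[of n] a
          by (simp add: z_def blinfun.scaleR_right blinfun.diff_right dist_norm)
      next
        fix \<phi> assume "\<phi> \<in> dual_space scl"
        hence "(\<lambda>n. \<phi> (y (r (t n)))) \<longlonglongrightarrow> \<phi> x"
          using LIMSEQ_subseq_LIMSEQ[OF x t(1)] by (simp add: o_def)
        from tendsto_scaleR[OF tendsto_const[of a] tendsto_diff[OF this tendsto_const[of "\<phi> x"]]]
        show "(\<lambda>n. \<phi> (z n)) \<longlonglongrightarrow> 0" by (simp add: z_def blinfun.scaleR_right blinfun.diff_right)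
      qed (use a t(2) in auto)
    qed
    have "(\<lambda>n. norm (V (y n) - s n)) \<longlonglongrightarrow> 0"
      by (rule tendsto_sandwich[OF _ _ tendsto_const LIMSEQ_inverse_real_of_nat])
        (use y(2) in \<open>auto simp: dist_norm intro!: always_eventually less_imp_le\<close>)
    hence "(\<lambda>n. V (y n) - s n) \<longlonglongrightarrow> 0" by (simp only: tendsto_norm_zero_iff)
    from LIMSEQ_subseq_LIMSEQ[OF this r] have "(\<lambda>n. V (y (r n)) - s (r n)) \<longlonglongrightarrow> 0"
      by (simp add: o_def)
    from tendsto_diff[OF Vlim this] have lim: "(s \<circ> r) \<longlonglongrightarrow> V x" by (simp add: o_def)
    moreover have "V x \<in> K"
      using closed_sequentially[of K "s \<circ> r" "V x"] s lim by (simp add: K_def)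
    ultimately show "\<exists>l\<in>K. \<exists>r. strict_mono r \<and> (s \<circ> r) \<longlonglongrightarrow> l" 
      using r by (intro bexI[of _ "V x"] exI[of _ r] conjI)
  qed
  thus ?thesis using V by (simp add: compact_ops_def K_def compact_eq_seq_compact_metric)
qed

end

subsection \<open>Compact operators and nuclear approximation\<close>

text \<open>A member of the cover that contains 0 misses only finitely many points. The intended set
  consists of vectors of geometrically decaying norm, together with 0.\<close>

lemma compact_if_finite_outside_balls:
  fixes S :: "'a::real_normed_vector set"
  assumes "0 \<in> S" "\<And>e. e > 0 \<Longrightarrow> finite {x \<in> S. e \<le> norm x}"
  shows "compact S"
proof (rule compactI)
  fix \<C> :: "'a set set" assume \<C>: "\<forall>U\<in>\<C>. open U" "S \<subseteq> \<Union>\<C>"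
  with assms(1) obtain U where U: "U \<in> \<C>" "0 \<in> U" by blast
  then obtain e where e: "e > 0" "ball 0 e \<subseteq> U" using \<C>(1) open_contains_ball by blast
  define F where "F = {x \<in> S. e \<le> norm x}"
  have "\<forall>x\<in>F. \<exists>W\<in>\<C>. x \<in> W" using \<C>(2) by (auto simp: F_def)
  then obtain w where w: "\<forall>x\<in>F. w x \<in> \<C> \<and> x \<in> w x" by metis
  have "S \<subseteq> \<Union>(insert U (w ` F))"
  proof
    fix x assume "x \<in> S"
    show "x \<in> \<Union>(insert U (w ` F))"
    proof (cases "e \<le> norm x")
      case True
      thus ?thesis using w \<open>x \<in> S\<close> by (auto simp: F_def)
    next
      case False
      hence "x \<in> ball 0 e" by simp
      thus ?thesis using e(2) by blast
    qed
  qed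
  moreover have "finite (insert U (w ` F))" using assms(2)[OF e(1)] by (simp add: F_def)
  moreover have "insert U (w ` F) \<subseteq> \<C>" using U w by auto
  ultimately show "\<exists>\<C>'\<subseteq>\<C>. finite \<C>' \<and> S \<subseteq> \<Union>\<C>'" by blast
qed

context banach_space_over
begin

lemma compact_ops_bounded: "a \<in> compact_ops scl \<Longrightarrow> a \<in> bounded_ops scl"
  by (simp add: compact_ops_def)

lemma compact_opsI:
  assumes "T \<in> bounded_ops scl" "compact K" "T ` cball 0 1 \<subseteq> K"
  shows "T \<in> compact_ops scl"
proof -
  have "closure (T ` cball 0 1) \<subseteq> K"
    using assms(2,3) by (intro closure_minimal compact_imp_closed)
  hence "compact (K \<inter> closure (T ` cball 0 1))" by (intro compact_Int_closed assms) simp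
  moreover have "K \<inter> closure (T ` cball 0 1) = closure (T ` cball 0 1)"
    using \<open>closure (T ` cball 0 1) \<subseteq> K\<close> by blast
  ultimately show ?thesis using assms(1) by (simp add: compact_ops_def)
qed

lemma compact_ops_scaleR:
  assumes "a \<in> compact_ops scl"
  shows "r *\<^sub>R a \<in> compact_ops scl"
proof (rule compact_opsI)
  show "r *\<^sub>R a \<in> bounded_ops scl"
    using assms by (auto simp: compact_ops_def bounded_ops_iff blinfun.scaleR_left scl_scaleR_right)
  show "compact ((*\<^sub>R) r ` closure (a ` cball 0 1))"
    using assms by (intro compact_scaling) (simp add: compact_ops_def)
  show "(r *\<^sub>R a) ` cball 0 1 \<subseteq> (*\<^sub>R) r ` closure (a ` cball 0 1)"
    by (auto simp: blinfun.scaleR_left intro!: imageI closure_subset[THEN subsetD])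
qed

lemma compact_ops_tens:
  assumes "\<phi> \<in> dual_space scl"
  shows "tens x \<phi> \<in> compact_ops scl"
proof (rule compact_opsI)
  show "tens x \<phi> \<in> bounded_ops scl" using assms by (simp add: bounded_ops_iff dual_space_iff)
  have "continuous_on UNIV (\<lambda>c. scl c x)"
    by (intro linear_continuous_on bounded_bilinear.bounded_linear_left[OF bounded_bilinear_scl])
  thus "compact ((\<lambda>c. scl c x) ` cball 0 (norm \<phi>))"
    by (intro compact_continuous_image) (auto intro: continuous_on_subset)
  show "tens x \<phi> ` cball 0 1 \<subseteq> (\<lambda>c. scl c x) ` cball 0 (norm \<phi>)"
  proof clarify
    fix z :: 'e assume "z \<in> cball 0 1"
    hence "norm (\<phi> z) \<le> norm \<phi>"
      using norm_blinfun[of \<phi> z] mult_left_le[of "norm z" "norm \<phi>"] by simp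
    thus "tens x \<phi> z \<in> (\<lambda>c. scl c x) ` cball 0 (norm \<phi>)" by (auto intro!: imageI)
  qed
qed

lemma compact_ops_zero: "0 \<in> compact_ops scl"
  by (rule compact_opsI[of _ "{0}"]) (auto simp: bounded_ops_iff)

text \<open>The approximation property, applied to the compact closure of the image of the unit
  ball, gives a finite-rank \<open>R\<close> with \<open>R o\<^sub>L x\<close> uniformly close to
  \<open>x\<close>.\<close>

lemma finite_tensor_dense_compact_ops:
  assumes ap: "approximation_property scl" and x: "x \<in> compact_ops scl" and e: "e > 0"
  obtains us where "set us \<subseteq> UNIV \<times> dual_space scl" "norm (x - finite_tensor us) \<le> e"
proof -
  have "compact (closure (x ` cball 0 1))" and xb: "x \<in> bounded_ops scl"
    using x by (auto simp: compact_ops_def)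
  then obtain R where R: "R \<in> finite_rank_ops scl"
    "\<And>y. y \<in> closure (x ` cball 0 1) \<Longrightarrow> norm (R y - y) < e"
    using ap e unfolding approximation_property_def by meson
  obtain us where us: "set us \<subseteq> UNIV \<times> dual_space scl" "R = finite_tensor us"
    using finite_rank_ops_finite_tensor[OF R(1)] .
  define vs where "vs = map (\<lambda>(y, \<phi>). (y, \<phi> o\<^sub>L x)) us"
  have vs: "R o\<^sub>L x = finite_tensor vs"
    unfolding us(2) vs_def by (rule compose_finite_tensor(1)[OF xb])
  have "norm (x - (R o\<^sub>L x)) \<le> e"
  proof (rule norm_blinfun_bound)
    fix z
    show "norm ((x - (R o\<^sub>L x)) z) \<le> e * norm z"
    proof (cases "z = 0")
      case False
      define u where "u = inverse (norm z) *\<^sub>R z"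
      have u: "norm u = 1" "z = norm z *\<^sub>R u" using False by (auto simp: u_def)
      have "x u \<in> closure (x ` cball 0 1)" using u(1) by (intro closure_subset[THEN subsetD]) auto
      hence "norm (x u - R (x u)) \<le> e" using R(2) by (simp add: norm_minus_commute less_imp_le)
      hence "norm z * norm (x u - R (x u)) \<le> norm z * e" by (rule mult_left_mono) simp
      moreover have "(x - (R o\<^sub>L x)) z = norm z *\<^sub>R (x u - R (x u))"
        using arg_cong[OF u(2), of "blinfun_apply (x - (R o\<^sub>L x))"]
        by (simp add: blinfun.diff_left blinfun.scaleR_right scaleR_diff_right)
      ultimately show ?thesis by (simp add: mult.commute)
    qed simp
  qed (use e in simp)
  moreover have "set vs \<subseteq> UNIV \<times> dual_space scl"
    using us(1) xb by (auto simp: vs_def intro: dual_space_compose)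
  ultimately show ?thesis using that vs by auto
qed

text \<open>A finite-rank \<open>R\<close> that moves every point of the compact unit ball by less
  than 1 has trivial kernel, and so embeds the space into the span of a finite set.\<close>

lemma finite_dimensional_if_compact_identity:
  assumes ap: "approximation_property scl" and I: "id_blinfun \<in> compact_ops scl"
  shows "\<exists>Basis. finite_dimensional_vector_space scl Basis"
proof -
  have "compact (cball (0::'e) 1)" using I by (simp add: compact_ops_def)
  then obtain R where R: "R \<in> finite_rank_ops scl" "\<And>y. y \<in> cball 0 1 \<Longrightarrow> norm (R y - y) < 1"
    using ap unfolding approximation_property_def by (meson zero_less_one)
  obtain B where B: "R \<in> bounded_ops scl" "finite B" "range R \<subseteq> module.span scl B"
    using R(1) by (auto simp: finite_rank_ops_def)
  have lin: "Vector_Spaces.linear scl scl R" using B(1) by (simp add: bounded_ops_def)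
  interpret R: Vector_Spaces.linear scl scl R by (rule lin)
  have "x = 0" if "R x = 0" for x
  proof (rule ccontr)
    assume "x \<noteq> 0"
    hence "norm (R (inverse (norm x) *\<^sub>R x) - inverse (norm x) *\<^sub>R x) < 1" by (intro R(2)) simp
    thus False using that \<open>x \<noteq> 0\<close> by (simp add: blinfun.scaleR_right)
  qed
  hence inj: "inj R" by (simp add: R.inj_iff_eq_0)
  obtain S where S: "independent S" "span S = UNIV"
    using maximal_independent_subset[of UNIV] by (metis UNIV_eq_I subsetD UNIV_I)
  have "independent (R ` S)" by (rule R.independent_injective_image[OF S(1)]) (use inj in \<open>auto intro: inj_on_subset\<close>)
  hence "finite (R ` S)" using independent_span_bound[OF B(2)] B(3) by blast
  hence "finite S" using inj by (meson finite_imageD inj_on_subset subset_UNIV)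
  hence "finite_dimensional_vector_space scl S" using S by unfold_locales
  thus ?thesis by blast
qed

section \<open>Mass of a tensor and its trace estimates\<close>

text \<open>The infimum over all lists representing a given operator is its projective tensor norm,
  the nuclear norm of the overview.\<close>

definition tensor_mass :: "('e \<times> ('e \<Rightarrow>\<^sub>L 'k)) list \<Rightarrow> real" where
  "tensor_mass us = (\<Sum>(x, \<phi>)\<leftarrow>us. norm x * norm \<phi>)"

lemma tensor_mass_simps [simp]:
  "tensor_mass [] = 0"
  "tensor_mass ((x, \<phi>) # us) = norm x * norm \<phi> + tensor_mass us"
  "tensor_mass (us @ vs) = tensor_mass us + tensor_mass vs"
  by (simp_all add: tensor_mass_def)

lemma tensor_mass_nonneg: "0 \<le> tensor_mass us"
  by (induction us) auto

definition scale_tensor :: "'k \<Rightarrow> ('e \<times> ('e \<Rightarrow>\<^sub>L 'k)) list \<Rightarrow> ('e \<times> ('e \<Rightarrow>\<^sub>L 'k)) list" where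
  "scale_tensor c = map (\<lambda>(x, \<phi>). (scl c x, \<phi>))"

lemma scale_tensor_dual:
  "set us \<subseteq> UNIV \<times> dual_space scl \<Longrightarrow> set (scale_tensor c us) \<subseteq> UNIV \<times> dual_space scl"
  by (auto simp: scale_tensor_def)

lemma finite_tensor_scale_apply: "finite_tensor (scale_tensor c us) y = scl c (finite_tensor us y)"
  by (induction us)
    (auto simp: scale_tensor_def blinfun.add_left scale_right_distrib scale_left_commute)

lemma finite_tensor_scale_of_real:
  "finite_tensor (scale_tensor (of_real r) us) = r *\<^sub>R finite_tensor us"
  by (rule blinfun_eqI) (simp add: finite_tensor_scale_apply scale_of_real blinfun.scaleR_left)

lemma norm_finite_tensor_scale_le:
  "norm (finite_tensor (scale_tensor c us)) \<le> norm c * norm (finite_tensor us)"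
  by (rule norm_blinfun_bound)
    (auto simp: finite_tensor_scale_apply norm_scale mult.assoc intro!: mult_left_mono norm_blinfun)

lemma tensor_mass_scale: "tensor_mass (scale_tensor c us) = norm c * tensor_mass us"
  by (induction us) (auto simp: scale_tensor_def norm_scale algebra_simps)

lemma trace_pairing_scale:
  "V \<in> bounded_ops scl \<Longrightarrow> set us \<subseteq> UNIV \<times> dual_space scl \<Longrightarrow>
    trace_pairing V (scale_tensor c us) = c * trace_pairing V us"
  by (induction us) (auto simp: scale_tensor_def bounded_ops_iff dual_space_iff algebra_simps)

lemma trace_pairing_scaleR_left: "trace_pairing (r *\<^sub>R V) us = r *\<^sub>R trace_pairing V us"
  by (induction us) (auto simp: blinfun.scaleR_left blinfun.scaleR_right scaleR_add_right)

lemma norm_trace_pairing_le: "norm (trace_pairing V us) \<le> norm V * tensor_mass us"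
proof (induction us)
  case (Cons u us)
  obtain x \<phi> where u: "u = (x, \<phi>)" by fastforce
  have "norm (\<phi> (V x)) \<le> norm \<phi> * (norm V * norm x)"
    using norm_blinfun[of \<phi> "V x"] mult_left_mono[OF norm_blinfun[of V x], of "norm \<phi>"] by simp
  thus ?case using Cons norm_triangle_ineq[of "\<phi> (V x)" "trace_pairing V us"]
    by (simp add: u algebra_simps)
qed simp

text \<open>The rule tr(ST) = tr(TS). It decides which factor is measured by its operator norm and
  which by its mass.\<close>

lemma trace_pairing_commute:
  assumes "set us \<subseteq> UNIV \<times> dual_space scl" "set vs \<subseteq> UNIV \<times> dual_space scl"
  shows "trace_pairing (finite_tensor us) vs = trace_pairing (finite_tensor vs) us"
proof -
  have single: "trace_pairing (tens x \<phi>) vs = \<phi> (finite_tensor vs x)"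
    if "\<phi> \<in> dual_space scl" "set vs \<subseteq> UNIV \<times> dual_space scl" for x \<phi> vs
    using that by (induction vs) (auto simp: dual_space_iff blinfun.add_left blinfun.add_right)
  have add: "trace_pairing (S + T) vs = trace_pairing S vs + trace_pairing T vs" for S T vs
    by (induction vs) (auto simp: blinfun.add_left blinfun.add_right)
  have zero: "trace_pairing 0 vs = 0" for vs by (induction vs) auto
  show ?thesis using assms(1)
    by (induction us) (auto simp: zero add single assms(2))
qed

section \<open>Functionals on operators that are given by a trace\<close>

lemma tens_add_left: "tens (x + y) \<phi> = tens x \<phi> + tens y \<phi>"
  by (rule blinfun_eqI) (simp add: blinfun.add_left scale_right_distrib)

lemma tens_scale_left: "tens (scl c x) \<phi> = tens x (blinfun_mult_right c o\<^sub>L \<phi>)"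
  by (rule blinfun_eqI) (simp add: mult.commute)

lemma mult_right_one_compose [simp]: "blinfun_mult_right 1 o\<^sub>L \<phi> = (\<phi> :: 'e \<Rightarrow>\<^sub>L 'k)"
  by (rule blinfun_eqI) simp

lemma mult_right_mult_compose:
  "blinfun_mult_right c o\<^sub>L (blinfun_mult_right d o\<^sub>L \<phi>) = blinfun_mult_right (c * d) o\<^sub>L (\<phi> :: 'e \<Rightarrow>\<^sub>L 'k)"
  by (rule blinfun_eqI) (simp add: mult.assoc)

text \<open>
  \<open>V x\<close> represents the member \<open>F x\<close> of the bidual for which \<open>L (x \<otimes> c \<phi>)\<close> is the real
  part \<open>(c * F x \<phi>) \<bullet> 1\<close>.
\<close>

lemma operator_of_functional:
  assumes refl: "reflexive_space scl" and L: "linear L"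
    and le: "\<And>x \<phi>. \<phi> \<in> dual_space scl \<Longrightarrow> L (tens x \<phi>) \<le> norm x * norm \<phi>"
  obtains V where "V \<in> bounded_ops scl" "norm V \<le> 1"
    "\<And>us. set us \<subseteq> UNIV \<times> dual_space scl \<Longrightarrow> L (finite_tensor us) = trace_pairing V us \<bullet> 1"
proof -
  have lin: "linear (\<lambda>c. L (tens x (blinfun_mult_right c o\<^sub>L \<phi>)))" for x and \<phi> :: "'e \<Rightarrow>\<^sub>L 'k"
  proof (rule linearI)
    have "tens x (blinfun_mult_right (c + d) o\<^sub>L \<phi>) =
        tens x (blinfun_mult_right c o\<^sub>L \<phi>) + tens x (blinfun_mult_right d o\<^sub>L \<phi>)" for c d
      by (rule blinfun_eqI) (simp add: blinfun.add_left scale_left_distrib distrib_right)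
    thus "L (tens x (blinfun_mult_right (c + d) o\<^sub>L \<phi>)) =
        L (tens x (blinfun_mult_right c o\<^sub>L \<phi>)) + L (tens x (blinfun_mult_right d o\<^sub>L \<phi>))" for c d
      by (simp add: linear_add[OF L])
    have "tens x (blinfun_mult_right (r *\<^sub>R c) o\<^sub>L \<phi>) = r *\<^sub>R tens x (blinfun_mult_right c o\<^sub>L \<phi>)" for r c
      by (rule blinfun_eqI) (simp add: blinfun.scaleR_left scl_scaleR_left)
    thus "L (tens x (blinfun_mult_right (r *\<^sub>R c) o\<^sub>L \<phi>)) =
        r *\<^sub>R L (tens x (blinfun_mult_right c o\<^sub>L \<phi>))" for r c
      by (simp add: linear_scale[OF L])
  qed
  define F where "F x \<phi> = (THE u. \<forall>c. L (tens x (blinfun_mult_right c o\<^sub>L \<phi>)) = (c * u) \<bullet> 1)"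
    for x and \<phi> :: "'e \<Rightarrow>\<^sub>L 'k"
  have F: "L (tens x (blinfun_mult_right c o\<^sub>L \<phi>)) = (c * F x \<phi>) \<bullet> 1" for x c and \<phi> :: "'e \<Rightarrow>\<^sub>L 'k"
    using theI'[OF inner_one_representation[OF lin[of x \<phi>]]] unfolding F_def by blast
  have F_scale: "F x (blinfun_mult_right d o\<^sub>L \<phi>) = d * F x \<phi>" for x d and \<phi> :: "'e \<Rightarrow>\<^sub>L 'k"
  proof (rule inner_one_mult_separates)
    fix c
    show "(c * F x (blinfun_mult_right d o\<^sub>L \<phi>)) \<bullet> 1 = (c * (d * F x \<phi>)) \<bullet> 1"
      using F[of x c "blinfun_mult_right d o\<^sub>L \<phi>"] F[of x "c * d" \<phi>]
      by (simp add: mult_right_mult_compose mult.assoc)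
  qed
  have F_add: "F x (\<phi> + \<psi>) = F x \<phi> + F x \<psi>" for x and \<phi> \<psi> :: "'e \<Rightarrow>\<^sub>L 'k"
  proof (rule inner_one_mult_separates)
    fix c
    have "tens x (blinfun_mult_right c o\<^sub>L (\<phi> + \<psi>)) =
        tens x (blinfun_mult_right c o\<^sub>L \<phi>) + tens x (blinfun_mult_right c o\<^sub>L \<psi>)"
      by (rule blinfun_eqI) (simp add: blinfun.add_left scale_left_distrib distrib_left)
    thus "(c * F x (\<phi> + \<psi>)) \<bullet> 1 = (c * (F x \<phi> + F x \<psi>)) \<bullet> 1"
      using F[of x c "\<phi> + \<psi>"] F[of x c \<phi>] F[of x c \<psi>]
      by (simp add: linear_add[OF L] distrib_left inner_add_left)
  qed
  have F_le: "norm (F x \<phi>) \<le> norm x * norm \<phi>" if \<phi>: "\<phi> \<in> dual_space scl" for x \<phi>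
  proof (cases "F x \<phi> = 0")
    case False
    let ?c = "inverse (F x \<phi>)"
    have "1 = (?c * F x \<phi>) \<bullet> 1" using False inner_one_of_real[of 1] by simp
    also have "\<dots> = L (tens x (blinfun_mult_right ?c o\<^sub>L \<phi>))" by (rule F[symmetric])
    also have "\<dots> \<le> norm x * norm (blinfun_mult_right ?c o\<^sub>L \<phi>)"
      by (rule le) (rule dual_space_mult[OF \<phi>])
    also have "\<dots> \<le> norm x * (norm ?c * norm \<phi>)"
      by (intro mult_left_mono norm_mult_right_compose_le) simp
    finally have "1 \<le> norm x * norm \<phi> / norm (F x \<phi>)"
      by (simp add: norm_inverse divide_inverse mult_ac)
    thus ?thesis using False by (simp add: field_simps)
  qed simp
  have "\<exists>v. \<forall>\<phi>\<in>dual_space scl. F x \<phi> = \<phi> v" for x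
  proof -
    have "F x \<in> bidual_space scl" unfolding bidual_space_def
      using F_add F_scale F_le[of _ x] by (auto intro!: exI[of _ "norm x"])
    thus ?thesis using refl by (auto simp: reflexive_space_def)
  qed
  then obtain v where v: "\<And>x \<phi>. \<phi> \<in> dual_space scl \<Longrightarrow> \<phi> (v x) = F x \<phi>" by metis
  have v_add: "v (x + y) = v x + v y" for x y
  proof (rule dual_separates)
    fix \<phi> assume \<phi>: "\<phi> \<in> dual_space scl"
    have "F (x + y) \<phi> = F x \<phi> + F y \<phi>"
      by (rule inner_one_mult_separates)
        (simp add: tens_add_left linear_add[OF L] distrib_left inner_add_left flip: F)
    thus "\<phi> (v (x + y)) = \<phi> (v x + v y)" by (simp add: v[OF \<phi>] blinfun.add_right)
  qed
  have v_scale: "v (scl d x) = scl d (v x)" for d x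
  proof (rule dual_separates)
    fix \<phi> assume \<phi>: "\<phi> \<in> dual_space scl"
    have "F (scl d x) \<phi> = F x (blinfun_mult_right d o\<^sub>L \<phi>)"
    proof (rule inner_one_mult_separates)
      fix c
      show "(c * F (scl d x) \<phi>) \<bullet> 1 = (c * F x (blinfun_mult_right d o\<^sub>L \<phi>)) \<bullet> 1"
        using F[of "scl d x" c \<phi>] F[of x c "blinfun_mult_right d o\<^sub>L \<phi>"]
        by (simp add: tens_scale_left mult_right_mult_compose mult.commute)
    qed
    thus "\<phi> (v (scl d x)) = \<phi> (scl d (v x))"
      using \<phi> by (simp add: v F_scale dual_space_iff[THEN iffD1, rule_format, OF \<phi>])
  qed
  have v_le: "norm (v x) \<le> norm x" for x
  proof (rule norm_le_dual)
    fix \<phi> assume \<phi>: "\<phi> \<in> dual_space scl" "norm \<phi> \<le> 1"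
    show "norm (\<phi> (v x)) \<le> norm x"
      using F_le[OF \<phi>(1), of x] mult_left_le[OF \<phi>(2) norm_ge_zero[of x]] v[OF \<phi>(1), of x] by simp
  qed
  have "bounded_linear v"
  proof (rule bounded_linear_intro)
    show "v (r *\<^sub>R x) = r *\<^sub>R v x" for r x
      using v_scale[of "of_real r" x] by (simp add: scale_of_real)
    show "norm (v x) \<le> norm x * 1" for x using v_le by simp
  qed (rule v_add)
  hence ap: "blinfun_apply (Blinfun v) = v" by (rule bounded_linear_Blinfun_apply)
  show ?thesis
  proof (rule that[of "Blinfun v"])
    show "Blinfun v \<in> bounded_ops scl" by (simp add: bounded_ops_iff ap v_scale)
    show "norm (Blinfun v) \<le> 1" using v_le by (intro norm_blinfun_bound) (auto simp: ap)
    fix us :: "('e \<times> ('e \<Rightarrow>\<^sub>L 'k)) list" assume "set us \<subseteq> UNIV \<times> dual_space scl"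
    thus "L (finite_tensor us) = trace_pairing (Blinfun v) us \<bullet> 1"
    proof (induction us)
      case (Cons u us)
      obtain x \<phi> where u: "u = (x, \<phi>)" by fastforce
      have "L (tens x \<phi>) = \<phi> (v x) \<bullet> 1" using F[of x 1 \<phi>] Cons.prems by (simp add: u v)
      thus ?case using Cons by (simp add: u linear_add[OF L] ap inner_add_left)
    qed (simp add: linear_0[OF L])
  qed
qed

text \<open>The infimal convolution of the projective norm and \<open>K\<close> times the operator
  norm. The empty list bounds it by \<open>K * norm S\<close> on every operator, so that Hahn-Banach
  applies to the whole space; one-entry lists bound it by \<open>norm x * norm \<phi>\<close> on
  \<open>tens x \<phi>\<close>.\<close>

lemma sublinear_tensor_gauge:
  assumes K: "K \<ge> 0"
  shows "sublinear (\<lambda>S. INF vs\<in>{vs. set vs \<subseteq> UNIV \<times> dual_space scl}.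
    tensor_mass vs + K * norm (S - finite_tensor vs))" (is "sublinear ?p")
proof -
  let ?D = "{vs. set vs \<subseteq> UNIV \<times> dual_space scl}"
  have ne: "[] \<in> ?D" by simp
  have pos: "0 \<le> tensor_mass vs + K * norm (S - finite_tensor vs)" for vs S
    using K tensor_mass_nonneg by simp
  have bd: "bdd_below ((\<lambda>vs. tensor_mass vs + K * norm (S - finite_tensor vs)) ` ?D)" for S
    using pos by (intro bdd_belowI2[of _ 0])
  have le: "?p S \<le> tensor_mass vs + K * norm (S - finite_tensor vs)" if "vs \<in> ?D" for S vs
    using bd that by (rule cINF_lower)
  have ge: "c \<le> ?p S" if "\<And>vs. vs \<in> ?D \<Longrightarrow> c \<le> tensor_mass vs + K * norm (S - finite_tensor vs)" for c S
    by (rule cINF_greatest) (use ne that in blast)+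
  show ?thesis
  proof (rule sublinearI)
    fix S T
    have "?p (S + T) - (tensor_mass vs + K * norm (S - finite_tensor vs))
        \<le> tensor_mass ws + K * norm (T - finite_tensor ws)" if "vs \<in> ?D" "ws \<in> ?D" for vs ws
    proof -
      have "norm ((S - finite_tensor vs) + (T - finite_tensor ws))
          \<le> norm (S - finite_tensor vs) + norm (T - finite_tensor ws)" by (rule norm_triangle_ineq)
      moreover have "(S - finite_tensor vs) + (T - finite_tensor ws) = S + T - finite_tensor (vs @ ws)"
        by simp
      ultimately have "K * norm (S + T - finite_tensor (vs @ ws))
          \<le> K * (norm (S - finite_tensor vs) + norm (T - finite_tensor ws))"
        using K by (metis mult_left_mono)
      moreover have "?p (S + T) \<le> tensor_mass (vs @ ws) + K * norm (S + T - finite_tensor (vs @ ws))"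
        using that by (intro le) auto
      ultimately show ?thesis by (simp add: algebra_simps)
    qed
    hence "?p (S + T) - (tensor_mass vs + K * norm (S - finite_tensor vs)) \<le> ?p T"
      if "vs \<in> ?D" for vs using that by (intro ge)
    hence *: "?p (S + T) - ?p T \<le> tensor_mass vs + K * norm (S - finite_tensor vs)"
      if "vs \<in> ?D" for vs using that by (simp add: algebra_simps)
    have "?p (S + T) - ?p T \<le> ?p S" by (rule ge) (rule *)
    thus "?p (S + T) \<le> ?p S + ?p T" by (simp add: algebra_simps)
  next
    have "?p 0 \<le> 0" using le[OF ne, of 0] by simp
    moreover have "0 \<le> ?p 0" by (rule ge) (rule pos)
    ultimately show "?p 0 = 0" by (rule antisym)
  next
    fix r :: real and S assume r: "r > 0"
    have *: "?p (r *\<^sub>R S) / r \<le> tensor_mass vs + K * norm (S - finite_tensor vs)" if "vs \<in> ?D" for vs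
    proof -
      let ?ws = "scale_tensor (of_real r) vs"
      have "?p (r *\<^sub>R S) \<le> tensor_mass ?ws + K * norm (r *\<^sub>R S - finite_tensor ?ws)"
        using that by (intro le) (auto simp: scale_tensor_def)
      also have "r *\<^sub>R S - finite_tensor ?ws = r *\<^sub>R (S - finite_tensor vs)"
        by (simp add: finite_tensor_scale_of_real scaleR_diff_right)
      also have "tensor_mass ?ws + K * norm \<dots> = r * (tensor_mass vs + K * norm (S - finite_tensor vs))"
        using r by (simp add: tensor_mass_scale distrib_left)
      finally show ?thesis using r by (simp add: field_simps)
    qed
    have "?p (r *\<^sub>R S) / r \<le> ?p S" by (rule ge) (rule *)
    thus "?p (r *\<^sub>R S) \<le> r * ?p S" using r by (simp add: field_simps)
  qed
qed

text \<open>
  A Hahn--Banach functional norming the tensor for the gauge has the form \<open>tr (V \<cdot>)\<close> with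
  \<open>\<parallel>V\<parallel> \<le> 1\<close>. The gauge is at most \<open>K\<close> times the operator norm, so \<open>V\<close> is compact, and the trace
  hypothesis applies to \<open>V\<close> with the constant \<open>C\<close> in place of \<open>K\<close>.
\<close>

lemma finite_tensor_nuclear_approximation:
  assumes refl: "reflexive_space scl" and C: "0 \<le> C"
    and trace: "\<And>x us. x \<in> compact_ops scl \<Longrightarrow> set us \<subseteq> UNIV \<times> dual_space scl \<Longrightarrow>
      norm (trace_pairing x us) \<le> C * norm x * norm (finite_tensor us)"
    and us: "set us \<subseteq> UNIV \<times> dual_space scl"
    and K: "0 \<le> K" and e: "0 < e"
  obtains vs where "set vs \<subseteq> UNIV \<times> dual_space scl"
    "tensor_mass vs + K * norm (finite_tensor us - finite_tensor vs) < C * norm (finite_tensor us) + e"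
proof -
  let ?D = "{vs. set vs \<subseteq> UNIV \<times> dual_space scl}"
  define p where "p S = (INF vs\<in>?D. tensor_mass vs + K * norm (S - finite_tensor vs))" for S
  have "bdd_below ((\<lambda>vs. tensor_mass vs + K * norm (S - finite_tensor vs)) ` ?D)" for S
    using K tensor_mass_nonneg by (intro bdd_belowI2[of _ 0]) simp
  hence p_le: "p S \<le> tensor_mass vs + K * norm (S - finite_tensor vs)" if "vs \<in> ?D" for S vs
    unfolding p_def using that by (intro cINF_lower)
  have "sublinear p" unfolding p_def by (rule sublinear_tensor_gauge[OF K])
  then obtain L where L: "linear L" "\<And>S. L S \<le> p S" "L (finite_tensor us) = p (finite_tensor us)"
    using Hahn_Banach_sublinear by metis
  obtain V where V: "V \<in> bounded_ops scl" "norm V \<le> 1"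
    and LV: "\<And>us. set us \<subseteq> UNIV \<times> dual_space scl \<Longrightarrow> L (finite_tensor us) = trace_pairing V us \<bullet> 1"
  proof (rule operator_of_functional[OF refl L(1)])
    fix x \<phi> assume "\<phi> \<in> dual_space scl"
    thus "L (tens x \<phi>) \<le> norm x * norm \<phi>"
      using L(2)[of "tens x \<phi>"] p_le[of "[(x, \<phi>)]" "tens x \<phi>"] by simp
  qed blast
  have "norm (trace_pairing V ws) \<le> K * norm (finite_tensor ws)"
    if ws: "set ws \<subseteq> UNIV \<times> dual_space scl" for ws
  proof (cases "trace_pairing V ws = 0")
    case False
    \<comment> \<open>\<open>L\<close> sees only the real part of the trace; normalizing the trace
      to 1 recovers the absolute value with the same \<open>K\<close>.\<close>
    let ?c = "inverse (trace_pairing V ws)"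
    have "1 = trace_pairing V (scale_tensor ?c ws) \<bullet> 1"
      using False inner_one_of_real[of 1] by (simp add: trace_pairing_scale[OF V(1) ws])
    also have "\<dots> = L (finite_tensor (scale_tensor ?c ws))" by (simp add: LV scale_tensor_dual[OF ws])
    also have "\<dots> \<le> K * norm (finite_tensor (scale_tensor ?c ws))"
      using order_trans[OF L(2) p_le[of "[]"]] by simp
    also have "\<dots> \<le> K * (norm ?c * norm (finite_tensor ws))"
      using K by (intro mult_left_mono norm_finite_tensor_scale_le)
    finally have "1 \<le> K * norm (finite_tensor ws) / norm (trace_pairing V ws)"
      by (simp add: norm_inverse divide_inverse mult_ac)
    thus ?thesis using False by (simp add: field_simps)
  qed (use K in simp)
  hence "V \<in> compact_ops scl" by (rule trace_bounded_compact[OF refl V(1)])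
  have "p (finite_tensor us) \<le> norm (trace_pairing V us)"
    using LV[OF us] L(3) inner_one_le_norm[of "trace_pairing V us"] by simp
  also have "\<dots> \<le> C * norm V * norm (finite_tensor us)" by (rule trace[OF \<open>V \<in> compact_ops scl\<close> us])
  also have "\<dots> \<le> C * 1 * norm (finite_tensor us)"
    using V(2) C by (intro mult_right_mono mult_left_mono) auto
  also have "\<dots> < C * norm (finite_tensor us) + e" using e by simp
  finally have "p (finite_tensor us) < C * norm (finite_tensor us) + e" .
  then obtain vs where "vs \<in> ?D"
    "tensor_mass vs + K * norm (finite_tensor us - finite_tensor vs) < C * norm (finite_tensor us) + e"
    unfolding p_def by (subst (asm) cINF_less_iff)
      (use \<open>\<And>S. bdd_below _\<close> in \<open>auto intro!: exI[of _ "[]"]\<close>)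
  thus ?thesis using that by blast
qed

end

subsection \<open>The trace and the flip\<close>

context banach_space_over
begin

text \<open>With \<open>K = 2 * (C + 1)\<close> and the norm \<open>N\<close> itself as the excess,
  mass and weighted error together stay below \<open>(C + 1) * N\<close>. The mass uses at most all
  of this, and the error, which carries the factor \<open>2 * (C + 1)\<close>, is at most
  \<open>N / 2\<close>.\<close>

lemma halving_nuclear_approximation:
  assumes refl: "reflexive_space scl" and C: "0 \<le> C"
    and trace: "\<And>x us. x \<in> compact_ops scl \<Longrightarrow> set us \<subseteq> UNIV \<times> dual_space scl \<Longrightarrow>
      norm (trace_pairing x us) \<le> C * norm x * norm (finite_tensor us)"
    and us: "set us \<subseteq> UNIV \<times> dual_space scl"
  shows "\<exists>vs. set vs \<subseteq> UNIV \<times> dual_space scl \<and>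
    tensor_mass vs \<le> (C + 1) * norm (finite_tensor us) \<and>
    norm (finite_tensor us - finite_tensor vs) \<le> norm (finite_tensor us) / 2"
proof (cases "finite_tensor us = 0")
  case True
  thus ?thesis by (intro exI[of _ "[]"]) simp
next
  case False
  define N where "N = norm (finite_tensor us)"
  have N: "N > 0" using False by (simp add: N_def)
  obtain vs where vs: "set vs \<subseteq> UNIV \<times> dual_space scl"
    "tensor_mass vs + 2 * (C + 1) * norm (finite_tensor us - finite_tensor vs) < C * N + N"
    unfolding N_def
    by (rule finite_tensor_nuclear_approximation[OF refl C trace us, of "2 * (C + 1)" "norm (finite_tensor us)"])
      (use C False in auto)
  have "0 \<le> 2 * (C + 1) * norm (finite_tensor us - finite_tensor vs)" using C by simp
  hence "tensor_mass vs \<le> (C + 1) * N" using vs(2) unfolding distrib_right[of C 1 N] mult_1 by linarith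
  moreover have "(C + 1) * (2 * norm (finite_tensor us - finite_tensor vs)) \<le> (C + 1) * N"
    using vs(2) tensor_mass_nonneg[of vs] by (simp add: algebra_simps)
  hence "2 * norm (finite_tensor us - finite_tensor vs) \<le> N" using C by simp
  ultimately show ?thesis using vs(1) by (intro exI[of _ vs]) (auto simp: N_def)
qed

text \<open>Size is moved between the two factors of each term, which leaves every
  \<open>\<phi> (V x)\<close> unchanged.\<close>

lemma rescale_tensor:
  assumes us: "set us \<subseteq> UNIV \<times> dual_space scl" and s: "s > 0"
  shows "\<exists>vs. set vs \<subseteq> UNIV \<times> dual_space scl \<and> (\<forall>V. trace_pairing V vs = trace_pairing V us) \<and>
    (\<forall>(x, \<phi>)\<in>set vs. norm x \<le> s) \<and> (\<Sum>(x, \<phi>)\<leftarrow>vs. norm \<phi>) \<le> tensor_mass us / s"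
  using us
proof (induction us)
  case Nil
  show ?case by (rule exI[of _ "[]"]) simp
next
  case (Cons u us)
  obtain x \<phi> where u: "u = (x, \<phi>)" by fastforce
  obtain vs where vs: "set vs \<subseteq> UNIV \<times> dual_space scl" "\<And>V. trace_pairing V vs = trace_pairing V us"
    "\<forall>(x, \<phi>)\<in>set vs. norm x \<le> s" "(\<Sum>(x, \<phi>)\<leftarrow>vs. norm \<phi>) \<le> tensor_mass us / s"
    using Cons by auto
  \<comment> \<open>For \<open>x = 0\<close> the quotient \<open>s / norm x\<close> is 0 by
    convention, and both new factors vanish.\<close>
  define x' where "x' = (s / norm x) *\<^sub>R x"
  define \<phi>' where "\<phi>' = (norm x / s) *\<^sub>R \<phi>"
  have "\<phi>' (V x') = \<phi> (V x)" for V :: "'e \<Rightarrow>\<^sub>L 'e"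
    using s by (cases "x = 0") (auto simp: x'_def \<phi>'_def blinfun.scaleR_left blinfun.scaleR_right)
  moreover have "norm x' \<le> s" using s by (cases "x = 0") (auto simp: x'_def)
  moreover have "\<phi>' \<in> dual_space scl" unfolding \<phi>'_def
    using Cons.prems by (intro dual_space_scaleR) (simp add: u)
  moreover have "norm \<phi>' = norm x * norm \<phi> / s" using s by (simp add: \<phi>'_def)
  ultimately show ?case using vs
    by (intro exI[of _ "(x', \<phi>') # vs"]) (auto simp: u add_divide_distrib)
qed

text \<open>The approximation property controls \<open>R x - x\<close> on the left factors only; the
  summed norms of the right factors turn this into an error for traces.\<close>

lemma trace_pairing_perturb:
  fixes R :: "'e \<Rightarrow>\<^sub>L 'e"
  assumes "\<And>x \<phi>. (x, \<phi>) \<in> set us \<Longrightarrow> norm (R x - x) \<le> e"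
  shows "norm (trace_pairing R us - trace_pairing id_blinfun us) \<le> e * (\<Sum>(x, \<phi>)\<leftarrow>us. norm \<phi>)"
  using assms
proof (induction us)
  case (Cons u us)
  obtain x \<phi> where u: "u = (x, \<phi>)" by fastforce
  have "norm (\<phi> (R x) - \<phi> x) \<le> norm \<phi> * norm (R x - x)"
    using norm_blinfun[of \<phi> "R x - x"] by (simp add: blinfun.diff_right)
  also have "\<dots> \<le> norm \<phi> * e" using Cons.prems[of x \<phi>] by (intro mult_left_mono) (auto simp: u)
  finally have 1: "norm (\<phi> (R x) - \<phi> x) \<le> e * norm \<phi>" by (simp add: mult.commute)
  have 2: "norm (trace_pairing R us - trace_pairing id_blinfun us) \<le> e * (\<Sum>(x, \<phi>)\<leftarrow>us. norm \<phi>)"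
    using Cons.prems by (intro Cons.IH) (meson list.set_intros(2))
  have "trace_pairing R (u # us) - trace_pairing id_blinfun (u # us) =
      (\<phi> (R x) - \<phi> x) + (trace_pairing R us - trace_pairing id_blinfun us)"
    by (simp add: u)
  also have "norm \<dots> \<le> e * norm \<phi> + e * (\<Sum>(x, \<phi>)\<leftarrow>us. norm \<phi>)"
    by (rule order_trans[OF norm_triangle_ineq add_mono[OF 1 2]])
  finally show ?case by (simp add: u distrib_left)
qed simp

text \<open>
  Iterated halving writes the operator as a nuclear series, and the approximation property identifies
  the trace of the series with the trace of the tensor. The left factors are rescaled to the size
  \<open>(3/4)\<^sup>k\<close>, between \<open>(1/2)\<^sup>k\<close> and \<open>1\<close>, so that they form a compact set while the right
  factors stay summable.
\<close>

lemma trace_bounded_by_operator_norm: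
  assumes refl: "reflexive_space scl" and ap: "approximation_property scl" and C: "0 \<le> C"
    and trace: "\<And>x us. x \<in> compact_ops scl \<Longrightarrow> set us \<subseteq> UNIV \<times> dual_space scl \<Longrightarrow>
      norm (trace_pairing x us) \<le> C * norm x * norm (finite_tensor us)"
    and us: "set us \<subseteq> UNIV \<times> dual_space scl"
  shows "norm (trace_pairing id_blinfun us) \<le> 2 * (C + 1) * norm (finite_tensor us)"
proof -
  let ?D = "\<lambda>us. set us \<subseteq> UNIV \<times> dual_space scl"
  have "\<forall>us\<in>Collect ?D. \<exists>vs. ?D vs \<and>
      tensor_mass vs \<le> (C + 1) * norm (finite_tensor us) \<and>
      norm (finite_tensor us - finite_tensor vs) \<le> norm (finite_tensor us) / 2"
    using halving_nuclear_approximation[OF refl C trace] by simp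
  then obtain a where a: "\<forall>us\<in>Collect ?D. ?D (a us) \<and>
      tensor_mass (a us) \<le> (C + 1) * norm (finite_tensor us) \<and>
      norm (finite_tensor us - finite_tensor (a us)) \<le> norm (finite_tensor us) / 2"
    by (rule bchoice[THEN exE])
  \<comment> \<open>The remainders after removal of the approximants, kept as lists so that their
    traces telescope.\<close>
  define U where "U = rec_nat us (\<lambda>_ ws. ws @ scale_tensor (of_real (- 1)) (a ws))"
  define W where "W k = a (U k)" for k
  have U0: "U 0 = us" and U_Suc: "U (Suc k) = U k @ scale_tensor (of_real (- 1)) (W k)" for k
    by (simp_all add: U_def W_def)
  have UD: "?D (U k)" for k
  proof (induction k)
    case (Suc k)
    hence "?D (W k)" using a by (simp add: W_def)
    from scale_tensor_dual[OF this] Suc show ?case by (simp add: U_Suc)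
  qed (simp add: U0 us)
  have WD: "?D (W k)" and W_mass: "tensor_mass (W k) \<le> (C + 1) * norm (finite_tensor (U k))"
    and U_half: "norm (finite_tensor (U k) - finite_tensor (W k)) \<le> norm (finite_tensor (U k)) / 2" for k
    using a UD[of k] by (auto simp: W_def)
  define N where "N = norm (finite_tensor us)"
  have "N \<ge> 0" by (simp add: N_def)
  have U_norm: "norm (finite_tensor (U k)) \<le> N * (1 / 2) ^ k" for k
  proof (induction k)
    case (Suc k)
    have "finite_tensor (U (Suc k)) = finite_tensor (U k) - finite_tensor (W k)"
      unfolding U_Suc by (simp only: finite_tensor_simps finite_tensor_scale_of_real) simp
    thus ?case using U_half[of k] Suc by simp
  qed (simp add: U0 N_def)
  have mass: "tensor_mass (W k) \<le> (C + 1) * (N * (1 / 2) ^ k)" for k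
    by (rule order_trans[OF W_mass mult_left_mono[OF U_norm]]) (use C in simp)
  have tr_U: "trace_pairing V (U n) = trace_pairing V us - (\<Sum>k<n. trace_pairing V (W k))"
    if V: "V \<in> bounded_ops scl" for V n
    by (induction n) (simp_all add: U0 U_Suc trace_pairing_scale[OF V WD])
  have "\<forall>k. \<exists>vs. ?D vs \<and> (\<forall>V. trace_pairing V vs = trace_pairing V (W k)) \<and>
    (\<forall>(x, \<phi>)\<in>set vs. norm x \<le> (3/4)^k) \<and> (\<Sum>(x, \<phi>)\<leftarrow>vs. norm \<phi>) \<le> tensor_mass (W k) / (3/4)^k"
    using rescale_tensor[OF WD] by simp
  then obtain W' where W': "\<And>k V. trace_pairing V (W' k) = trace_pairing V (W k)"
    "\<And>k x \<phi>. (x, \<phi>) \<in> set (W' k) \<Longrightarrow> norm x \<le> (3/4)^k"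
    "\<And>k. (\<Sum>(x, \<phi>)\<leftarrow>W' k. norm \<phi>) \<le> tensor_mass (W k) / (3/4)^k"
    unfolding choice_iff by (auto; blast)
  define S where "S = insert 0 (fst ` set us \<union> (\<Union>k. fst ` set (W' k)))"
  have "compact S"
  proof (rule compact_if_finite_outside_balls)
    fix e :: real assume "e > 0"
    then obtain n where n: "(3/4 :: real) ^ n < e" using real_arch_pow_inv[of e "3/4"] by auto
    have "{x \<in> S. e \<le> norm x} \<subseteq> fst ` set us \<union> (\<Union>k<n. fst ` set (W' k))"
    proof
      fix x assume x: "x \<in> {x \<in> S. e \<le> norm x}"
      show "x \<in> fst ` set us \<union> (\<Union>k<n. fst ` set (W' k))"
      proof (cases "x \<in> fst ` set us")
        case False
        with x \<open>e > 0\<close> obtain k \<phi> where k: "(x, \<phi>) \<in> set (W' k)" by (force simp: S_def)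
        have "k < n"
        proof (rule ccontr)
          assume "\<not> k < n"
          hence "(3/4 :: real) ^ k \<le> (3/4) ^ n" by (intro power_decreasing) auto
          moreover have "e \<le> norm x" using x by simp
          ultimately show False using W'(2)[OF k] n by linarith
        qed
        thus ?thesis using k by force
      qed simp
    qed
    thus "finite {x \<in> S. e \<le> norm x}" by (rule finite_subset) auto
  qed (simp add: S_def)
  define w where "w = (\<Sum>(x, \<phi>)\<leftarrow>us. norm \<phi>)"
  have "w \<ge> 0" unfolding w_def by (intro sum_list_nonneg) auto
  \<comment> \<open>The main term is the geometric sum of the masses of the \<open>W k\<close>.
    Replacing the identity by \<open>R\<close> costs \<open>e * w\<close> on \<open>us\<close> and
    \<open>e * 3 * (C + 1) * N\<close> on all \<open>W k\<close>, as the powers of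
    \<open>2/3\<close> sum to 3; one more \<open>e\<close> pays for the remainder.\<close>
  have approx: "norm (trace_pairing id_blinfun us) \<le> 2 * (C + 1) * N + e * (w + 3 * (C + 1) * N + 1)"
    if e: "e > 0" for e
  proof -
    obtain R where R: "R \<in> finite_rank_ops scl" "\<And>x. x \<in> S \<Longrightarrow> norm (R x - x) < e"
      using ap e \<open>compact S\<close> unfolding approximation_property_def by meson
    obtain gs where gs: "?D gs" "R = finite_tensor gs" using finite_rank_ops_finite_tensor[OF R(1)] .
    have Rb: "R \<in> bounded_ops scl" using R(1) by (simp add: finite_rank_ops_def)
    \<comment> \<open>\<open>n\<close> comes after \<open>R\<close>: the mass of the list for
      \<open>R\<close> is then fixed, and the remainder can be made small against it.\<close>
    obtain n where n: "N * (1 / 2) ^ n * tensor_mass gs \<le> e"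
    proof -
      have "(\<lambda>n. N * (1 / 2) ^ n * tensor_mass gs) \<longlonglongrightarrow> N * 0 * tensor_mass gs"
        by (intro tendsto_intros LIMSEQ_power_zero) simp
      hence "\<forall>\<^sub>F n in sequentially. N * (1 / 2) ^ n * tensor_mass gs < e"
        by (rule order_tendstoD(2)) (use e in simp)
      then obtain n where "N * (1 / 2) ^ n * tensor_mass gs < e"
        by (auto simp: eventually_sequentially)
      thus ?thesis by (intro that less_imp_le)
    qed
    have us_le: "norm (trace_pairing id_blinfun us) \<le> norm (trace_pairing R us) + e * w"
    proof -
      have "norm (trace_pairing R us - trace_pairing id_blinfun us) \<le> e * w"
        unfolding w_def
      proof (intro trace_pairing_perturb less_imp_le R(2))
        fix x \<phi> assume "(x, \<phi>) \<in> set us"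
        from imageI[OF this, of fst] show "x \<in> S" by (simp add: S_def)
      qed
      thus ?thesis using norm_triangle_ineq3[of "trace_pairing R us" "trace_pairing id_blinfun us"]
        by linarith
    qed
    have W_le: "norm (trace_pairing R (W k)) \<le> (C + 1) * N * (1/2)^k + e * (C + 1) * N * (2/3)^k" for k
    proof -
      have "norm (trace_pairing R (W' k) - trace_pairing id_blinfun (W' k))
          \<le> e * (\<Sum>(x, \<phi>)\<leftarrow>W' k. norm \<phi>)"
      proof (intro trace_pairing_perturb less_imp_le R(2))
        fix x \<phi> assume "(x, \<phi>) \<in> set (W' k)"
        from imageI[OF this, of fst] show "x \<in> S" by (auto simp: S_def)
      qed
      also have "\<dots> \<le> e * (tensor_mass (W k) / (3/4)^k)" using W'(3) e by (intro mult_left_mono) auto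
      also have "\<dots> \<le> e * ((C + 1) * (N * (1 / 2) ^ k) / (3/4)^k)"
        using mass e by (intro mult_left_mono divide_right_mono) auto
      also have "\<dots> = e * (C + 1) * N * ((1 / 2) ^ k / (3/4)^k)" by simp
      also have "(1 / 2 :: real) ^ k / (3/4)^k = (2/3)^k" by (simp flip: power_divide)
      finally have "norm (trace_pairing R (W k) - trace_pairing id_blinfun (W k)) \<le> e * (C + 1) * N * (2/3)^k"
        by (simp only: W'(1))
      moreover have "norm (trace_pairing id_blinfun (W k)) \<le> (C + 1) * (N * (1/2)^k)"
      proof -
        have "norm (id_blinfun :: 'e \<Rightarrow>\<^sub>L 'e) \<le> 1" by (rule norm_blinfun_id_le)
        from mult_right_mono[OF this tensor_mass_nonneg[of "W k"]]
        show ?thesis using norm_trace_pairing_le[of id_blinfun "W k"] mass[of k] by simp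
      qed
      ultimately show ?thesis
        using norm_triangle_ineq3[of "trace_pairing R (W k)" "trace_pairing id_blinfun (W k)"]
        by (simp add: mult.assoc)
    qed
    have "(\<Sum>k<n. (1/2 :: real) ^ k) \<le> 2" "(\<Sum>k<n. (2/3 :: real) ^ k) \<le> 3"
      by (simp_all add: geometric_sum)
    hence sums: "(C + 1) * N * (\<Sum>k<n. (1/2) ^ k) \<le> (C + 1) * N * 2"
      "e * (C + 1) * N * (\<Sum>k<n. (2/3) ^ k) \<le> e * (C + 1) * N * 3"
      using C \<open>N \<ge> 0\<close> e by (intro mult_left_mono; simp)+
    have "norm (\<Sum>k<n. trace_pairing R (W k)) \<le>
        (\<Sum>k<n. (C + 1) * N * (1/2)^k + e * (C + 1) * N * (2/3)^k)"
      by (rule order_trans[OF norm_sum sum_mono[OF W_le]])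
    also have "\<dots> = (C + 1) * N * (\<Sum>k<n. (1/2) ^ k) + e * (C + 1) * N * (\<Sum>k<n. (2/3) ^ k)"
      by (simp add: sum.distrib sum_distrib_left)
    finally have W_sum: "norm (\<Sum>k<n. trace_pairing R (W k)) \<le> (C + 1) * N * 2 + e * (C + 1) * N * 3"
      using sums by linarith
    \<comment> \<open>The remainder is known to be small in operator norm, not in mass, so it has to
      act as the operator and \<open>R\<close> as the tensor.\<close>
    have "norm (trace_pairing R (U n)) = norm (trace_pairing (finite_tensor (U n)) gs)"
      unfolding gs(2) using trace_pairing_commute[OF gs(1) UD] by simp
    also have "\<dots> \<le> norm (finite_tensor (U n)) * tensor_mass gs" by (rule norm_trace_pairing_le)
    also have "\<dots> \<le> N * (1/2)^n * tensor_mass gs"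
      by (intro mult_right_mono U_norm tensor_mass_nonneg)
    finally have "norm (trace_pairing R (U n)) \<le> e" using n by linarith
    moreover have "trace_pairing R us = trace_pairing R (U n) + (\<Sum>k<n. trace_pairing R (W k))"
      by (simp add: tr_U[OF Rb])
    ultimately have "norm (trace_pairing R us) \<le> e + ((C + 1) * N * 2 + e * (C + 1) * N * 3)"
      using W_sum norm_triangle_ineq[of "trace_pairing R (U n)" "\<Sum>k<n. trace_pairing R (W k)"]
      by simp
    thus ?thesis using us_le by (simp add: algebra_simps)
  qed
  define Q where "Q = w + 3 * (C + 1) * N + 1"
  have Q: "Q > 0" using \<open>w \<ge> 0\<close> C \<open>N \<ge> 0\<close> by (simp add: Q_def add_nonneg_pos)
  have "norm (trace_pairing id_blinfun us) \<le> 2 * (C + 1) * N + e" if "e > 0" for e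
    using approx[of "e / Q"] that Q unfolding Q_def[symmetric] by simp
  thus ?thesis unfolding N_def by (rule field_le_epsilon)
qed

theorem finite_dimensional_if_trace_form_bounded:
  assumes refl: "reflexive_space scl" and ap: "approximation_property scl" and C: "0 \<le> C"
    and trace: "\<And>x us. x \<in> compact_ops scl \<Longrightarrow> set us \<subseteq> UNIV \<times> dual_space scl \<Longrightarrow>
      norm (trace_pairing x us) \<le> C * norm x * norm (finite_tensor us)"
  shows "\<exists>Basis. finite_dimensional_vector_space scl Basis"
proof (rule finite_dimensional_if_compact_identity[OF ap])
  show "id_blinfun \<in> compact_ops scl"
  proof (rule trace_bounded_compact[OF refl])
    show "id_blinfun \<in> bounded_ops scl" by (simp add: bounded_ops_iff)
  qed (rule trace_bounded_by_operator_norm[OF refl ap C trace])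
qed

section \<open>Elementary operators and their flips\<close>

text \<open>Unlike \<open>elementary_op\<close> this takes its formula on all operators, so it is a
  bounded linear map on the whole space.\<close>

definition elementary_sum :: "(('e \<Rightarrow>\<^sub>L 'e) \<times> ('e \<Rightarrow>\<^sub>L 'e)) list \<Rightarrow> ('e \<Rightarrow>\<^sub>L 'e) \<Rightarrow> ('e \<Rightarrow>\<^sub>L 'e)" where
  "elementary_sum ps x = (\<Sum>(a, b)\<leftarrow>ps. a o\<^sub>L x o\<^sub>L b)"

lemma elementary_sum_simps [simp]:
  "elementary_sum [] x = 0"
  "elementary_sum ((a, b) # ps) x = (a o\<^sub>L x o\<^sub>L b) + elementary_sum ps x"
  by (simp_all add: elementary_sum_def)

lemma elementary_op_eq: "x \<in> A \<Longrightarrow> elementary_op A ps x = elementary_sum ps x"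
  by (simp add: elementary_op_def elementary_sum_def)

lemma elementary_op_eq_iff:
  "elementary_op A ps = elementary_op A qs \<longleftrightarrow> (\<forall>x\<in>A. elementary_sum ps x = elementary_sum qs x)"
  by (auto simp: elementary_op_def elementary_sum_def fun_eq_iff restrict_def)

lemma bounded_linear_elementary_sum: "bounded_linear (elementary_sum ps)"
proof (induction ps)
  case Nil
  have "elementary_sum [] = (\<lambda>x. 0)" by (rule ext) simp
  thus ?case by simp
next
  case (Cons p ps)
  obtain a b where p: "p = (a, b)" by fastforce
  have "elementary_sum (p # ps) = (\<lambda>x. (a o\<^sub>L x o\<^sub>L b) + elementary_sum ps x)"
    by (rule ext) (simp add: p)
  moreover have "bounded_linear (\<lambda>x. a o\<^sub>L x o\<^sub>L b)"
    by (rule bounded_linear_compose[OF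
        bounded_bilinear.bounded_linear_left[OF bounded_bilinear_blinfun_compose]
        bounded_bilinear.bounded_linear_right[OF bounded_bilinear_blinfun_compose]])
  ultimately show ?case using Cons by (simp add: bounded_linear_add)
qed

text \<open>
  The flip is an exchange of rank-one test data, so it is determined by the operator alone.
\<close>

lemma elementary_sum_swap:
  assumes "set ps \<subseteq> bounded_ops scl \<times> bounded_ops scl" "g \<in> dual_space scl" "\<psi> \<in> dual_space scl"
  shows "g (elementary_sum (map prod.swap ps) (tens v \<psi>) y) = \<psi> (elementary_sum ps (tens y g) v)"
  using assms(1)
  by (induction ps)
    (use assms(2,3) in \<open>auto simp: blinfun.add_left blinfun.add_right bounded_ops_iff dual_space_iff mult.commute\<close>)

text \<open>Pairing with \<open>g\<close> and \<open>y\<close> exchanges the flipped difference at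
  \<open>tens v \<psi>\<close> for the unflipped one at \<open>tens y g\<close>, where the bound
  \<open>N\<close> applies.\<close>

lemma elementary_sum_difference_swap:
  assumes "set ps \<subseteq> bounded_ops scl \<times> bounded_ops scl" "set qs \<subseteq> bounded_ops scl \<times> bounded_ops scl"
    and "\<psi> \<in> dual_space scl" "N \<ge> 0"
    and N: "\<And>y g. g \<in> dual_space scl \<Longrightarrow>
      norm (elementary_sum ps (tens y g) - elementary_sum qs (tens y g)) \<le> N * norm (tens y g)"
  shows "norm (elementary_sum (map prod.swap ps) (tens v \<psi>) - elementary_sum (map prod.swap qs) (tens v \<psi>))
    \<le> N * norm v * norm \<psi>"
proof (rule norm_blinfun_bound)
  fix y
  let ?X = "elementary_sum (map prod.swap ps) (tens v \<psi>) - elementary_sum (map prod.swap qs) (tens v \<psi>)"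
  show "norm (?X y) \<le> N * norm v * norm \<psi> * norm y"
  proof (rule norm_le_dual)
    fix g assume g: "g \<in> dual_space scl" "norm g \<le> 1"
    let ?Y = "elementary_sum ps (tens y g) - elementary_sum qs (tens y g)"
    have "norm (tens y g) \<le> norm y"
      using norm_tens_le[of y g] mult_left_le[OF g(2) norm_ge_zero[of y]] by linarith
    hence "norm ?Y \<le> N * norm y"
      using N[OF g(1), of y] mult_left_mono[of "norm (tens y g)" "norm y" N] assms(4) by linarith
    have "g (?X y) = \<psi> (?Y v)"
      using elementary_sum_swap[OF assms(1) g(1) assms(3)] elementary_sum_swap[OF assms(2) g(1) assms(3)]
      by (simp add: blinfun.diff_left blinfun.diff_right)
    also have "norm \<dots> \<le> norm \<psi> * (norm ?Y * norm v)"
      by (rule order_trans[OF norm_blinfun mult_left_mono[OF norm_blinfun norm_ge_zero]])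
    also have "\<dots> \<le> norm \<psi> * (N * norm y * norm v)"
      by (intro mult_left_mono mult_right_mono \<open>norm ?Y \<le> N * norm y\<close>) auto
    finally show "norm (g (?X y)) \<le> N * norm v * norm \<psi> * norm y" by (simp add: mult_ac)
  qed
qed (use assms(4) in simp)

text \<open>Additivity turns the rank-one estimate into one with the mass as factor. The case
  \<open>N = 0\<close> shows that the flip is well defined; representations of mass proportional to
  \<open>norm x\<close> show that it is continuous.\<close>

lemma elementary_sum_difference_swap_finite:
  assumes "set ps \<subseteq> bounded_ops scl \<times> bounded_ops scl" "set qs \<subseteq> bounded_ops scl \<times> bounded_ops scl"
    and "N \<ge> 0"
    and N: "\<And>y g. g \<in> dual_space scl \<Longrightarrow>
      norm (elementary_sum ps (tens y g) - elementary_sum qs (tens y g)) \<le> N * norm (tens y g)"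
    and us: "set us \<subseteq> UNIV \<times> dual_space scl"
  shows "norm (elementary_sum (map prod.swap ps) (finite_tensor us)
      - elementary_sum (map prod.swap qs) (finite_tensor us)) \<le> N * tensor_mass us"
  using us
proof (induction us)
  case Nil
  show ?case by (simp add: linear_0 bounded_linear.linear[OF bounded_linear_elementary_sum])
next
  case (Cons u us)
  obtain v \<psi> where u: "u = (v, \<psi>)" by fastforce
  let ?P = "elementary_sum (map prod.swap ps)" and ?Q = "elementary_sum (map prod.swap qs)"
  have "?P (finite_tensor (u # us)) - ?Q (finite_tensor (u # us)) =
      (?P (tens v \<psi>) - ?Q (tens v \<psi>)) + (?P (finite_tensor us) - ?Q (finite_tensor us))"
    by (simp add: u linear_add bounded_linear.linear[OF bounded_linear_elementary_sum])
  also have "norm \<dots> \<le> N * norm v * norm \<psi> + N * tensor_mass us"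
    by (rule order_trans[OF norm_triangle_ineq add_mono[OF
        elementary_sum_difference_swap[OF assms(1,2) _ assms(3) N] Cons.IH]])
      (use Cons.prems in \<open>auto simp: u\<close>)
  finally show ?case by (simp add: u algebra_simps)
qed

text \<open>On finite tensors this is the estimate with \<open>N = 0\<close>; density, from the
  approximation property, extends it to compact operators. It supplies the uniqueness behind
  \<open>THE\<close> in \<open>elementary_flip\<close>.\<close>

lemma elementary_op_swap_cong:
  assumes ap: "approximation_property scl"
    and ps: "set ps \<subseteq> compact_ops scl \<times> compact_ops scl"
    and qs: "set qs \<subseteq> compact_ops scl \<times> compact_ops scl"
    and eq: "elementary_op (compact_ops scl) ps = elementary_op (compact_ops scl) qs"
  shows "elementary_op (compact_ops scl) (map prod.swap ps) = elementary_op (compact_ops scl) (map prod.swap qs)"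
  unfolding elementary_op_eq_iff
proof
  fix x assume x: "x \<in> compact_ops scl"
  let ?P = "elementary_sum (map prod.swap ps)" and ?Q = "elementary_sum (map prod.swap qs)"
  have b: "set ps \<subseteq> bounded_ops scl \<times> bounded_ops scl" "set qs \<subseteq> bounded_ops scl \<times> bounded_ops scl"
    using ps qs compact_ops_bounded by blast+
  have fin: "?P (finite_tensor us) = ?Q (finite_tensor us)" if "set us \<subseteq> UNIV \<times> dual_space scl" for us
    using elementary_sum_difference_swap_finite[OF b, of 0 us] that eq
    by (simp add: elementary_op_eq_iff compact_ops_tens)
  have lin: "bounded_linear (\<lambda>x. ?P x - ?Q x)"
    by (intro bounded_linear_sub bounded_linear_elementary_sum)
  obtain L where L: "L > 0" "\<And>x. norm (?P x - ?Q x) \<le> norm x * L"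
    using bounded_linear.pos_bounded[OF lin] by blast
  have "norm (?P x - ?Q x) \<le> 0 + e" if "e > 0" for e
  proof -
    obtain us where us: "set us \<subseteq> UNIV \<times> dual_space scl" "norm (x - finite_tensor us) \<le> e / L"
      using finite_tensor_dense_compact_ops[OF ap x, of "e / L"] \<open>e > 0\<close> L(1) by auto
    have "?P x - ?Q x = ?P (x - finite_tensor us) - ?Q (x - finite_tensor us)"
      using fin[OF us(1)] by (simp add: linear_diff bounded_linear.linear[OF bounded_linear_elementary_sum])
    also have "norm \<dots> \<le> norm (x - finite_tensor us) * L" by (rule L(2))
    also have "\<dots> \<le> e" using us(2) L(1) by (simp add: field_simps)
    finally show ?thesis by simp
  qed
  hence "norm (?P x - ?Q x) \<le> 0" by (rule field_le_epsilon)
  thus "?P x = ?Q x" by simp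
qed

lemma elementary_flip_elementary_op:
  assumes "approximation_property scl" and "set ps \<subseteq> compact_ops scl \<times> compact_ops scl"
  shows "elementary_flip (compact_ops scl) (elementary_op (compact_ops scl) ps) =
    elementary_op (compact_ops scl) (map prod.swap ps)"
  unfolding elementary_flip_def
  by (rule the_equality) (use assms elementary_op_swap_cong[OF assms(1)] in metis)+

text \<open>A real supremum dominates its members only when they are bounded above; bounded
  linearity of the elementary sums guarantees this.\<close>

lemma norm_elementary_difference_le:
  assumes "x \<in> compact_ops scl" "norm x \<le> 1"
  shows "norm (elementary_sum ps x - elementary_sum qs x) \<le> norm_on (compact_ops scl)
    (\<lambda>x. elementary_op (compact_ops scl) ps x - elementary_op (compact_ops scl) qs x)"
proof -
  have lin: "bounded_linear (\<lambda>x. elementary_sum ps x - elementary_sum qs x)"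
    by (intro bounded_linear_sub bounded_linear_elementary_sum)
  obtain L where L: "L > 0" "\<And>x. norm (elementary_sum ps x - elementary_sum qs x) \<le> norm x * L"
    using bounded_linear.pos_bounded[OF lin] by blast
  have "norm (elementary_op (compact_ops scl) ps y - elementary_op (compact_ops scl) qs y) \<le> L"
    if "y \<in> compact_ops scl" "norm y \<le> 1" for y
    using order_trans[OF L(2)[of y], of L] mult_right_mono[OF that(2), of L] L(1) that(1)
    by (simp add: elementary_op_eq)
  hence "norm (elementary_op (compact_ops scl) ps x - elementary_op (compact_ops scl) qs x) \<le>
    norm_on (compact_ops scl)
      (\<lambda>x. elementary_op (compact_ops scl) ps x - elementary_op (compact_ops scl) qs x)"
    unfolding norm_on_def using assms by (intro cSUP_upper bdd_aboveI2[where M = L]) auto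
  thus ?thesis using assms(1) by (simp add: elementary_op_eq)
qed

lemma norm_elementary_difference_le_mult:
  assumes x: "x \<in> compact_ops scl"
  shows "norm (elementary_sum ps x - elementary_sum qs x) \<le> norm_on (compact_ops scl)
    (\<lambda>x. elementary_op (compact_ops scl) ps x - elementary_op (compact_ops scl) qs x) * norm x"
proof (cases "x = 0")
  case True
  thus ?thesis by (simp add: linear_0 bounded_linear.linear[OF bounded_linear_elementary_sum])
next
  case False
  let ?D = "\<lambda>x. elementary_sum ps x - elementary_sum qs x"
  have "norm (inverse (norm x) *\<^sub>R x) \<le> 1" using False by simp
  from norm_elementary_difference_le[OF compact_ops_scaleR[OF x] this, of ps qs]
  have "norm x * norm (?D (inverse (norm x) *\<^sub>R x)) \<le> norm x * norm_on (compact_ops scl)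
      (\<lambda>x. elementary_op (compact_ops scl) ps x - elementary_op (compact_ops scl) qs x)"
    by (rule mult_left_mono) simp
  moreover have "?D (inverse (norm x) *\<^sub>R x) = inverse (norm x) *\<^sub>R ?D x"
    by (simp add: linear_scale bounded_linear.linear[OF bounded_linear_elementary_sum]
        scaleR_diff_right)
  moreover have "norm x * norm (inverse (norm x) *\<^sub>R ?D x) = norm (?D x)"
    using False by (simp flip: mult.assoc)
  ultimately show ?thesis by (simp only: mult.commute)
qed

lemma norm_on_nonneg:
  "0 \<le> norm_on (compact_ops scl)
    (\<lambda>x. elementary_op (compact_ops scl) ps x - elementary_op (compact_ops scl) qs x)"
  by (rule order_trans[OF norm_ge_zero norm_elementary_difference_le[OF compact_ops_zero]]) simp

text \<open>
  The tensors \<open>\<Sum>\<^sub>j (e\<^sub>j \<otimes> \<phi>) \<otimes> (y \<otimes> f\<^sub>j)\<close> give the operators \<open>x \<mapsto> \<phi>(x y) \<Sum>\<^sub>j e\<^sub>j \<otimes> f\<^sub>j\<close>, whose flips are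
  \<open>x \<mapsto> (\<Sum>\<^sub>j f\<^sub>j(x e\<^sub>j)) y \<otimes> \<phi>\<close>.
\<close>

lemma elementary_sum_rank_one:
  fixes y z :: 'e
  assumes "x \<in> bounded_ops scl" "set us \<subseteq> UNIV \<times> dual_space scl" "\<phi> \<in> dual_space scl"
  defines "ps \<equiv> map (\<lambda>(e, f). (tens e \<phi>, tens y f)) us"
  shows "elementary_sum ps x z = scl (\<phi> (x y)) (finite_tensor us z)"
    and "elementary_sum (map prod.swap ps) x z = scl (\<phi> z * trace_pairing x us) y"
  unfolding ps_def using assms(1-3)
  by (induction us)
    (auto simp: blinfun.add_left blinfun.add_right bounded_ops_iff dual_space_iff scale_right_distrib
      scale_left_distrib distrib_left mult_ac)

text \<open>Continuity at the zero operator \<open>?op []\<close> gives \<open>\<delta>\<close>. The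
  operator built from \<open>us\<close> has norm at most \<open>norm (finite_tensor us)\<close>, and
  its flip at \<open>x\<close>, evaluated at the unit vector \<open>y\<close>, is the trace times
  \<open>y\<close>. Homogeneity then yields the constant \<open>2 / \<delta>\<close>.\<close>

lemma trace_form_bounded_if_flip_continuous:
  assumes ap: "approximation_property scl"
    and cont: "norm_continuous_on (compact_ops scl) (elementary_ops (compact_ops scl))
      (elementary_flip (compact_ops scl))"
  obtains C where "0 \<le> C" "\<And>x us. x \<in> compact_ops scl \<Longrightarrow> set us \<subseteq> UNIV \<times> dual_space scl \<Longrightarrow>
      norm (trace_pairing x us) \<le> C * norm x * norm (finite_tensor us)"
proof (cases "\<exists>y::'e. y \<noteq> 0")
  case False
  \<comment> \<open>The zero space contains no unit vector, but all its traces vanish.\<close>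
  have "trace_pairing x us = 0" for x us
    using norm_trace_pairing_le[of x us] norm_blinfun_bound[of 0 x] False by simp
  thus ?thesis using that[of 0] by simp
next
  case True
  then obtain y0 :: 'e where "y0 \<noteq> 0" by blast
  define y where "y = inverse (norm y0) *\<^sub>R y0"
  have y: "norm y = 1" using \<open>y0 \<noteq> 0\<close> by (simp add: y_def)
  obtain \<phi> where \<phi>: "\<phi> \<in> dual_space scl" "norm \<phi> \<le> 1" "\<phi> y = 1"
    using dual_norming[of y] y by auto
  let ?A = "compact_ops scl"
  let ?op = "elementary_op (compact_ops scl)"
  have "?op [] \<in> elementary_ops ?A" unfolding elementary_ops_def by (intro CollectI exI[of _ "[]"]) simp
  then obtain \<delta> where \<delta>: "\<delta> > 0" "\<And>S. S \<in> elementary_ops ?A \<Longrightarrow> norm_on ?A (\<lambda>x. S x - ?op [] x) < \<delta> \<Longrightarrow>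
      norm_on ?A (\<lambda>x. elementary_flip ?A S x - elementary_flip ?A (?op []) x) < 1"
    using cont unfolding norm_continuous_on_def by (meson zero_less_one)
  have small: "norm (trace_pairing x us) \<le> 1"
    if us: "set us \<subseteq> UNIV \<times> dual_space scl" and less: "norm (finite_tensor us) < \<delta>"
      and x: "x \<in> ?A" "norm x \<le> 1" for x us
  proof -
    define ps where "ps = map (\<lambda>(e, f). (tens e \<phi>, tens y f)) us"
    have ps: "set ps \<subseteq> ?A \<times> ?A" unfolding ps_def using us \<phi>(1) by (auto intro!: compact_ops_tens)
    have "norm_on ?A (\<lambda>x. ?op ps x - ?op [] x) \<le> norm (finite_tensor us)"
      unfolding norm_on_def
    proof (rule cSUP_least)
      show "{x \<in> ?A. norm x \<le> 1} \<noteq> {}" using compact_ops_zero by force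
      fix x assume x: "x \<in> {x \<in> ?A. norm x \<le> 1}"
      have "norm (x y) \<le> 1" using norm_blinfun[of x y] x y by simp
      hence "norm (\<phi> (x y)) \<le> 1"
        using norm_blinfun[of \<phi> "x y"] mult_le_one[OF \<phi>(2) norm_ge_zero] by (meson order_trans)
      hence "norm (elementary_sum ps x) \<le> norm (finite_tensor us)"
        using elementary_sum_rank_one(1)[OF compact_ops_bounded us \<phi>(1), of x y] x
          mult_left_le_one_le[OF norm_ge_zero norm_ge_zero, of "\<phi> (x y)"]
        by (intro norm_blinfun_bound)
          (auto simp: ps_def norm_scale intro: order_trans[OF _ norm_blinfun])
      thus "norm (?op ps x - ?op [] x) \<le> norm (finite_tensor us)"
        using x by (simp add: elementary_op_eq)
    qed
    moreover have "?op ps \<in> elementary_ops ?A" using ps by (auto simp: elementary_ops_def)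
    ultimately have "norm_on ?A (\<lambda>x. elementary_flip ?A (?op ps) x - elementary_flip ?A (?op []) x) < 1"
      using \<delta>(2)[of "?op ps"] less by linarith
    hence "norm_on ?A (\<lambda>x. ?op (map prod.swap ps) x - ?op [] x) < 1"
      using elementary_flip_elementary_op[OF ap ps] elementary_flip_elementary_op[OF ap, of "[]"] by simp
    hence "norm (elementary_sum (map prod.swap ps) x) < 1"
      using norm_elementary_difference_le[OF x, of "map prod.swap ps" "[]"] by simp
    hence "norm (elementary_sum (map prod.swap ps) x y) < 1"
      using norm_blinfun[of "elementary_sum (map prod.swap ps) x" y] y by simp
    moreover have "elementary_sum (map prod.swap ps) x y = scl (trace_pairing x us) y"
      using elementary_sum_rank_one(2)[OF compact_ops_bounded[OF x(1)] us \<phi>(1), of y y] \<phi>(3)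
      by (simp add: ps_def)
    ultimately show ?thesis using y by (simp add: norm_scale)
  qed
  have "norm (trace_pairing x us) \<le> 2 / \<delta> * norm x * norm (finite_tensor us)"
    if x: "x \<in> ?A" and us: "set us \<subseteq> UNIV \<times> dual_space scl" for x us
  proof -
    have bound: "norm (trace_pairing x us) * r * s \<le> 1"
      if "r > 0" "r * norm x \<le> 1" "s > 0" "s * norm (finite_tensor us) < \<delta>" for r s
    proof -
      have "norm (trace_pairing (r *\<^sub>R x) (scale_tensor (of_real s) us)) \<le> 1"
        using that by (intro small compact_ops_scaleR x scale_tensor_dual us)
          (auto simp: finite_tensor_scale_of_real)
      moreover have "trace_pairing (r *\<^sub>R x) (scale_tensor (of_real s) us) =
          r *\<^sub>R (of_real s * trace_pairing x us)"
        using trace_pairing_scale[OF compact_ops_bounded[OF x] us]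
        by (simp add: trace_pairing_scaleR_left)
      ultimately show ?thesis using that by (simp add: norm_mult mult_ac)
    qed
    have zero: "norm (trace_pairing x us) = 0" if "x = 0"
      using norm_trace_pairing_le[of x us] that by simp
    show ?thesis
    proof (cases "x = 0")
      case False
      \<comment> \<open>The scale \<open>s\<close> stays free because the tensor may vanish: then
        every positive \<open>s\<close> is admissible and the trace must be 0. Otherwise
        \<open>s\<close> brings the tensor to norm \<open>\<delta> / 2\<close>.\<close>
      have t: "norm (trace_pairing x us) * s \<le> norm x" if "s > 0" "s * norm (finite_tensor us) < \<delta>" for s
        using bound[of "inverse (norm x)" s] that False by (simp add: field_simps)
      show ?thesis
      proof (cases "finite_tensor us = 0")
        case True
        have "norm (trace_pairing x us) = 0"
        proof (rule ccontr)
          assume "norm (trace_pairing x us) \<noteq> 0"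
          hence "2 * norm x \<le> norm x"
            using t[of "2 * norm x / norm (trace_pairing x us)"] True \<open>x \<noteq> 0\<close> \<delta>(1) by simp
          thus False using \<open>x \<noteq> 0\<close> by simp
        qed
        thus ?thesis using \<delta>(1) by simp
      next
        case False
        thus ?thesis using t[of "\<delta> / (2 * norm (finite_tensor us))"] \<delta>(1) by (simp add: field_simps)
      qed
    qed (use zero in simp)
  qed
  thus ?thesis using that[of "2 / \<delta>"] \<delta>(1) by simp
qed

text \<open>The identity is a finite tensor, of mass \<open>c\<close> say; composing it with
  \<open>x\<close> represents \<open>x\<close> with mass at most \<open>c * norm x\<close>. Hence
  the flip is Lipschitz with constant \<open>c\<close>.\<close>

lemma flip_continuous_if_finite_dimensional:
  assumes ap: "approximation_property scl" and "finite_dimensional_vector_space scl B"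
  shows "norm_continuous_on (compact_ops scl) (elementary_ops (compact_ops scl))
    (elementary_flip (compact_ops scl))"
proof -
  interpret fd: finite_dimensional_vector_space scl B by fact
  let ?A = "compact_ops scl"
  let ?op = "elementary_op (compact_ops scl)"
  obtain us where us: "set us \<subseteq> UNIV \<times> dual_space scl" "\<And>x. finite_tensor us x = x"
    using finite_tensor_identity_on_span[OF fd.finite_Basis] fd.span_Basis by auto
  have compose_mass: "tensor_mass (map (\<lambda>(e, \<phi>). (e, \<phi> o\<^sub>L x)) ws) \<le> tensor_mass ws * norm x"
    for ws :: "('e \<times> ('e \<Rightarrow>\<^sub>L 'k)) list" and x
  proof (induction ws)
    case (Cons w ws)
    obtain e \<phi> where w: "w = (e, \<phi>)" by fastforce
    have "norm e * norm (\<phi> o\<^sub>L x) \<le> norm e * (norm \<phi> * norm x)"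
      by (intro mult_left_mono norm_blinfun_compose) simp
    thus ?case using Cons by (simp add: w algebra_simps)
  qed simp
  define c where "c = tensor_mass us"
  have "c \<ge> 0" by (simp add: c_def tensor_mass_nonneg)
  have flip_le: "norm_on ?A (\<lambda>x. ?op (map prod.swap ps) x - ?op (map prod.swap qs) x)
      \<le> c * norm_on ?A (\<lambda>x. ?op ps x - ?op qs x)"
    if ps: "set ps \<subseteq> ?A \<times> ?A" and qs: "set qs \<subseteq> ?A \<times> ?A" for ps qs
    unfolding norm_on_def[of ?A "\<lambda>x. ?op (map prod.swap ps) x - ?op (map prod.swap qs) x"]
  proof (rule cSUP_least)
    show "{x \<in> ?A. norm x \<le> 1} \<noteq> {}" using compact_ops_zero by force
    fix x assume "x \<in> {x \<in> ?A. norm x \<le> 1}"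
    hence x: "x \<in> ?A" "norm x \<le> 1" by auto
    define N where "N = norm_on ?A (\<lambda>x. ?op ps x - ?op qs x)"
    have "N \<ge> 0" unfolding N_def by (rule norm_on_nonneg)
    define vs where "vs = map (\<lambda>(e, \<phi>). (e, \<phi> o\<^sub>L x)) us"
    have xb: "x \<in> bounded_ops scl" using x(1) by (rule compact_ops_bounded)
    have "x = finite_tensor us o\<^sub>L x" by (rule blinfun_eqI) (simp add: us(2))
    hence xv: "x = finite_tensor vs" using compose_finite_tensor(1)[OF xb, of us] by (simp add: vs_def)
    have b: "set ps \<subseteq> bounded_ops scl \<times> bounded_ops scl" "set qs \<subseteq> bounded_ops scl \<times> bounded_ops scl"
      using ps qs compact_ops_bounded by blast+
    have vs: "set vs \<subseteq> UNIV \<times> dual_space scl"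
      using us(1) xb by (auto simp: vs_def intro: dual_space_compose)
    have "norm (elementary_sum ps (tens y g) - elementary_sum qs (tens y g)) \<le> N * norm (tens y g)"
      if "g \<in> dual_space scl" for y g
      unfolding N_def by (rule norm_elementary_difference_le_mult[OF compact_ops_tens[OF that]])
    from elementary_sum_difference_swap_finite[OF b \<open>N \<ge> 0\<close> this vs]
    have "norm (elementary_sum (map prod.swap ps) x - elementary_sum (map prod.swap qs) x)
        \<le> N * tensor_mass vs" using xv by simp
    also have "\<dots> \<le> N * (c * norm x)"
      using compose_mass[of x us] \<open>N \<ge> 0\<close> unfolding vs_def c_def by (rule mult_left_mono)
    also have "\<dots> \<le> N * (c * 1)" using x(2) \<open>N \<ge> 0\<close> \<open>c \<ge> 0\<close> by (intro mult_left_mono) auto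
    finally show "norm (?op (map prod.swap ps) x - ?op (map prod.swap qs) x)
        \<le> c * norm_on ?A (\<lambda>x. ?op ps x - ?op qs x)"
      using x(1) by (simp add: elementary_op_eq N_def mult.commute)
  qed
  show ?thesis unfolding norm_continuous_on_def
  proof (intro ballI allI impI)
    fix T and \<epsilon> :: real assume "T \<in> elementary_ops ?A" "\<epsilon> > 0"
    then obtain qs where qs: "set qs \<subseteq> ?A \<times> ?A" "T = ?op qs" by (auto simp: elementary_ops_def)
    show "\<exists>\<delta>>0. \<forall>S\<in>elementary_ops ?A. norm_on ?A (\<lambda>x. S x - T x) < \<delta> \<longrightarrow>
        norm_on ?A (\<lambda>x. elementary_flip ?A S x - elementary_flip ?A T x) < \<epsilon>"
    \<comment> \<open>The shift by 1 covers \<open>c = 0\<close>, which occurs on the zero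
      space.\<close>
    proof (intro exI[of _ "\<epsilon> / (c + 1)"] conjI ballI impI)
      show "0 < \<epsilon> / (c + 1)" using \<open>\<epsilon> > 0\<close> \<open>c \<ge> 0\<close> by simp
      fix S assume "S \<in> elementary_ops ?A" and less: "norm_on ?A (\<lambda>x. S x - T x) < \<epsilon> / (c + 1)"
      then obtain ps where ps: "set ps \<subseteq> ?A \<times> ?A" "S = ?op ps" by (auto simp: elementary_ops_def)
      have "norm_on ?A (\<lambda>x. elementary_flip ?A S x - elementary_flip ?A T x)
          \<le> c * norm_on ?A (\<lambda>x. S x - T x)"
        using flip_le[OF ps(1) qs(1)]
        by (simp add: ps(2) qs(2) elementary_flip_elementary_op[OF ap ps(1)]
            elementary_flip_elementary_op[OF ap qs(1)])
      also have "\<dots> \<le> c * (\<epsilon> / (c + 1))" using less \<open>c \<ge> 0\<close> by (intro mult_left_mono) auto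
      also have "\<dots> < \<epsilon>" using \<open>\<epsilon> > 0\<close> \<open>c \<ge> 0\<close> by (simp add: field_simps)
      finally show "norm_on ?A (\<lambda>x. elementary_flip ?A S x - elementary_flip ?A T x) < \<epsilon>" .
    qed
  qed
qed

end

theorem theorem1p1:
  fixes scl :: "'k::{real_normed_field, euclidean_space} \<Rightarrow> 'e::banach \<Rightarrow> 'e"
  assumes "banach_space_over scl"
    and "reflexive_space scl"
    and "approximation_property scl"
  shows "norm_continuous_on (compact_ops scl) (elementary_ops (compact_ops scl))
           (elementary_flip (compact_ops scl)) \<longleftrightarrow>
         (\<exists>Basis. finite_dimensional_vector_space scl Basis)"
proof -
  interpret banach_space_over scl by fact
  show ?thesis
    using trace_form_bounded_if_flip_continuous[OF assms(3)]
      finite_dimensional_if_trace_form_bounded[OF assms(2,3)]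
      flip_continuous_if_finite_dimensional[OF assms(3)] by metis
qed

end
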